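(* If $\mathfrak{g}$ is of type $A_n$ ($n\geq1$), then for every $i\in I$ the coefficients (with respect to the basis $\{:\!m\!:\,\mid m\in A\}$) of the $q,t$-character $F_t(\tilde Y_{i,0})=\chi_{q,t}(X_{i,0})$ of the $i$-th fundamental representation are in $\mathbb{N}[t^{\pm1}]$.
   Context: Data of type $A_n$. $I=\{1,\dots,n\}$, $C_{i,i}=2$, $C_{i,j}=-1$ if $|i-j|=1$, $C_{i,j}=0$ otherwise. $z$ is an indeterminate, $C(z)_{i,i}=z+z^{-1}$, $C(z)_{i,j}=C_{i,j}$ ($i\neq j$), $\tilde C(z)=C(z)^{-1}$; $(\tilde C_{i,j})_r\in\mathbb{Z}$ is the coefficient of $z^r$ in the expansion of $\tilde C_{i,j}(z)$ in $\mathbb{Z}((z^{-1}))$. Monomials. $\mathcal{Y}=\mathbb{Z}[Y_{i,l}^{\pm1}]_{i\in I,l\in\mathbb{Z}}$ (commutative), $A$ is its set of Laurent monomials $m=\prod Y_{i,l}^{u_{i,l}(m)}$, and $A_{i,l}=Y_{i,l-1}Y_{i,l+1}\prod_{|j-i|=1}Y_{j,l}^{-1}$. $B_i=\{m\in A:u_{i,l}(m)\ge0\ \forall l\}$, $B_J=\bigcap_{i\in J}B_i$ ($J$-dominant monomials), $B=B_I$ (dominant monomials). The algebra $\mathcal{Y}_t$. It is the free $\mathbb{Z}[t^{\pm1}]$-module with basis $\{:\!m\!:\,\mid m\in A\}$ and $\mathbb{Z}[t^{\pm1}]$-bilinear associative product $:\!m_1\!:\,:\!m_2\!:\,=t^{\mathcal{N}(m_1,m_2)}:\!m_1m_2\!:$,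 where $\mathcal{N}:A\times A\to\mathbb{Z}$ is the bicharacter with $\mathcal{N}(Y_{i,l},Y_{j,k})=(\tilde C_{j,i})_{1+l-k}-(\tilde C_{j,i})_{-1+l-k}$. Put $\tilde Y_{i,l}=:\!Y_{i,l}\!:$, $\tilde A_{i,l}=:\!A_{i,l}\!:$ (invertible, $\tilde A_{i,l}^{-1}=:\!A_{i,l}^{-1}\!:$). The monomials of an element are the $m\in A$ such that $:\!m\!:$ has nonzero coefficient. $\overset{\rightarrow}{\prod}_{l}$ is the product ordered by increasing $l$. Completions. For $m\in B_i$ put $E_{i,t}(m)=\overset{\rightarrow}{\prod}_{l\in\mathbb{Z}}\bigl((\tilde Y_{i,l}(1+t\tilde A_{i,l+1}^{-1}))^{u_{i,l}(m)}\prod_{j\ne i}\tilde Y_{j,l}^{u_{j,l}(m)}\bigr)$. Let $\mathcal{Y}_t^{A,K}$ be the $\mathbb{Z}[t^{\pm1}]$-span of the $:\!a\!:$ with $a$ a product of $K$ elements $A_{j,l}^{-1}$, $\mathcal{Y}_t^{A,\infty}=\prod_{K\ge0}\mathcal{Y}_t^{A,K}$, and $\mathcal{Y}_t^\infty=\sum_{M\in A}:\!M\!:\mathcal{Y}_t^{A,\infty}\subset\prod_{m\in A}\mathbb{Z}[t^{\pm1}]:\!m\!:$ (finite sums over $M$). $\mathfrak{K}_{i,t}^\infty\subset\mathcal{Y}_t^\infty$ is the set of finite sums, over $M\in A$, of elements $\sum_{K\ge0}\sum_a\lambda_a(t)E_{i,t}(Ma)$, where for each $K$ the inner sum is over finitely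 many products $a$ of $K$ elements $A_{j,l}^{-1}$ with $Ma\in B_i$, $\lambda_a(t)\in\mathbb{Z}[t^{\pm1}]$. $\mathfrak{K}_t^\infty=\bigcap_{i\in I}\mathfrak{K}_{i,t}^\infty$. The sets $D_m$. Let $\mathfrak{K}_i\subset\mathcal{Y}$ be the subring generated by the $Y_{i,l}(1+A_{i,l+1}^{-1})$ and $Y_{j,l}^{\pm1}$ ($j\neq i$, $l\in\mathbb{Z}$) and $\mathfrak{K}_J=\bigcap_{i\in J}\mathfrak{K}_i$. For $j\in J\subset I$ it is known (Frenkel–Reshetikhin, Frenkel–Mukhin) that there is a unique $E_J(Y_{j,l})\in\mathfrak{K}_J$ whose only $J$-dominant monomial is $Y_{j,l}$, with coefficient 1. For $m\in B_J$ put $E_J(m)=\prod_{i\notin J,l}Y_{i,l}^{u_{i,l}(m)}\prod_{j\in J,l}E_J(Y_{j,l})^{u_{j,l}(m)}$. For $m\in A$, $D_m$ is the set of $m'\in A$ for which there is a finite sequence $(m_0=m,m_1,\dots,m_R=m')$ such that for all $1\le r\le R$ there are $r'<r$ and $J\subset I$ with $m_{r'}\in B_J$ and, for all $r'<r''\le r$, $m_{r''}$ is a monomial of $E_J(m_{r'})$ and $m_{r''}m_{r''-1}^{-1}\in\{A_{j,l}^{-1}:l\in\mathbb{Z},j\in J\}$. $\tilde D_m\subset\mathcal{Y}_t^\infty$ is the submodule of all sums $\sum_{m'\in D_m}\lambda_{m'}(t):\!m'\!:$. $F_t(\tilde Y_{i,0})$ is the unique element of $\mathfrak{K}_t^\infty\cap\tilde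 D_{Y_{i,0}}$ whose unique dominant monomial is $Y_{i,0}$, with coefficient 1 (its existence may be assumed). By definition it is the $q,t$-character $\chi_{q,t}(X_{i,0})$ of the fundamental representation $X_{i,0}$. *)

theory Defs
  imports
    "HOL-Library.Poly_Mapping"
    "HOL-Algebra.Ring"
    "HOL-Computational_Algebra.Formal_Laurent_Series"
    "Jordan_Normal_Form.Matrix"
begin

section \<open>Laurent monomials\<close>

text \<open>The Laurent monomial \<open>\<Prod> Y\<^bsub>i,l\<^esub> ^ u\<^bsub>i,l\<^esub>\<close> is encoded by its finitely supported exponent
  vector, so multiplication of monomials is written \<^term>\<open>(+)\<close> and the unit monomial is \<^term>\<open>0\<close>.
  The product \<^term>\<open>(*)\<close> of \<open>\<Rightarrow>\<^sub>0\<close> is convolution; hence \<open>laurent\<close> is the ring \<open>\<int>[t, t\<^sup>-\<^sup>1]\<close>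
  and \<open>mono \<Rightarrow>\<^sub>0 int\<close> is the commutative ring of Laurent polynomials in all \<open>Y\<^bsub>i,l\<^esub>\<close>.\<close>

type_synonym mono = "(nat \<times> int) \<Rightarrow>\<^sub>0 int"
type_synonym laurent = "int \<Rightarrow>\<^sub>0 int"

abbreviation tpow :: "int \<Rightarrow> laurent" where
  "tpow k \<equiv> Poly_Mapping.single k 1"

definition Idx :: "nat \<Rightarrow> nat set" where
  "Idx n = {1..n}"

definition Mon :: "nat \<Rightarrow> mono set" where
  "Mon n = {m. Poly_Mapping.keys m \<subseteq> Idx n \<times> UNIV}"

definition Ymon :: "nat \<Rightarrow> int \<Rightarrow> mono" where
  "Ymon i l = Poly_Mapping.single (i, l) 1"

definition Amon :: "nat \<Rightarrow> nat \<Rightarrow> int \<Rightarrow> mono" where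
  "Amon n i l = Ymon i (l - 1) + Ymon i (l + 1)
     - (\<Sum>j\<in>{j \<in> Idx n. \<bar>int j - int i\<bar> = 1}. Ymon j l)"

definition dominant :: "nat \<Rightarrow> nat set \<Rightarrow> mono set" where
  "dominant n J = {m \<in> Mon n. \<forall>i\<in>J. \<forall>l. Poly_Mapping.lookup m (i, l) \<ge> 0}"

section \<open>The inverse of the quantized Cartan matrix\<close>

text \<open>Elements of \<open>\<int>((z\<^sup>-\<^sup>1))\<close> are formal Laurent series in \<open>X = z\<^sup>-\<^sup>1\<close>, so the coefficient of \<open>z\<^sup>r\<close>
  is the coefficient of \<open>X\<close> to the power \<open>-r\<close>. Matrix indices start at 0.\<close>

definition Cz :: "nat \<Rightarrow> int fls mat" where
  "Cz n = mat n n (\<lambda>(a, b). if a = b then fls_X_inv + fls_X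
                            else if \<bar>int a - int b\<bar> = 1 then - 1 else 0)"

definition Cz_inv :: "nat \<Rightarrow> int fls mat" where
  "Cz_inv n = inv\<^bsub>ring_mat TYPE(int fls) n ()\<^esub> (Cz n)"

definition Ctilde :: "nat \<Rightarrow> nat \<Rightarrow> nat \<Rightarrow> int \<Rightarrow> int" where
  "Ctilde n i j r = fls_nth (index_mat (Cz_inv n) (i - 1, j - 1)) (- r)"

section \<open>The algebra \<open>\<Y>\<^sub>t\<close>\<close>

definition Nform :: "nat \<Rightarrow> mono \<Rightarrow> mono \<Rightarrow> int" where
  "Nform n m1 m2 =
     (\<Sum>(i, l)\<in>Poly_Mapping.keys m1. \<Sum>(j, k)\<in>Poly_Mapping.keys m2.
        Poly_Mapping.lookup m1 (i, l) * Poly_Mapping.lookup m2 (j, k)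
        * (Ctilde n j i (1 + l - k) - Ctilde n j i (- 1 + l - k)))"

text \<open>\<open>bas m\<close> is the basis element \<open>:m:\<close>.\<close>

definition bas :: "mono \<Rightarrow> (mono \<Rightarrow>\<^sub>0 laurent)" where
  "bas m = Poly_Mapping.single m 1"

definition Yt :: "nat \<Rightarrow> (mono \<Rightarrow>\<^sub>0 laurent) ring" where
  "Yt n = \<lparr> carrier = {x. Poly_Mapping.keys x \<subseteq> Mon n},
            mult = (\<lambda>x y. \<Sum>m1\<in>Poly_Mapping.keys x. \<Sum>m2\<in>Poly_Mapping.keys y.
                      Poly_Mapping.single (m1 + m2)
                        (tpow (Nform n m1 m2)
                          * Poly_Mapping.lookup x m1 * Poly_Mapping.lookup y m2)),
            one = bas 0, zero = 0, add = (+) \<rparr>"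

definition ordprod :: "nat \<Rightarrow> (mono \<Rightarrow>\<^sub>0 laurent) list \<Rightarrow> (mono \<Rightarrow>\<^sub>0 laurent)" where
  "ordprod n xs = foldr (mult (Yt n)) xs \<one>\<^bsub>Yt n\<^esub>"

text \<open>Only meaningful for \<open>m \<in> dominant n {i}\<close>. The powers are powers in \<open>\<Y>\<^sub>t\<close> (for negative
  exponents, of the inverse in \<open>\<Y>\<^sub>t\<close>, which differs from \<open>bas\<close> of the inverse monomial by a power
  of \<open>t\<close>). For fixed \<open>l\<close> the elements \<open>bas (Ymon j l)\<close> commute, so the order chosen for the
  indices \<open>j\<close> is immaterial; levels \<open>l\<close> on which \<open>m\<close> vanishes contribute the factor one.\<close>

definition Eit :: "nat \<Rightarrow> nat \<Rightarrow> mono \<Rightarrow> (mono \<Rightarrow>\<^sub>0 laurent)" where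
  "Eit n i m = ordprod n (map (\<lambda>l.
       ((bas (Ymon i l) \<otimes>\<^bsub>Yt n\<^esub>
            (bas 0 + Poly_Mapping.single (- Amon n i (l + 1)) (tpow 1)))
          [^]\<^bsub>Yt n\<^esub> Poly_Mapping.lookup m (i, l))
       \<otimes>\<^bsub>Yt n\<^esub>
       ordprod n (map (\<lambda>j. bas (Ymon j l) [^]\<^bsub>Yt n\<^esub> Poly_Mapping.lookup m (j, l))
                      (filter (\<lambda>j. j \<noteq> i) [1..<n + 1])))
     (sorted_list_of_set (snd ` Poly_Mapping.keys m)))"

section \<open>Completions\<close>

text \<open>Elements of \<open>\<Prod>\<^bsub>m\<^esub> \<int>[t\<^sup>\<plusminus>\<^sup>1] :m:\<close> are coefficient functions \<open>mono \<Rightarrow> laurent\<close>.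
  \<open>Aprod n K\<close> is the set of products of \<open>K\<close> elements \<open>A\<^bsub>j,l\<^esub>\<^sup>-\<^sup>1\<close>.\<close>

definition Aprod :: "nat \<Rightarrow> nat \<Rightarrow> mono set" where
  "Aprod n K = {sum_list (map (\<lambda>(j, l). - Amon n j l) ps) | ps.
                  length ps = K \<and> set ps \<subseteq> Idx n \<times> UNIV}"

text \<open>An element of \<open>\<Prod>\<^sub>K \<Y>\<^sub>t\<^sup>A\<^sup>,\<^sup>K\<close> is determined by its coefficients because the sets
  \<open>Aprod n K\<close> are pairwise disjoint.\<close>

definition YtA_inf :: "nat \<Rightarrow> (mono \<Rightarrow> laurent) set" where
  "YtA_inf n = {x. {m. x m \<noteq> 0} \<subseteq> (\<Union>K. Aprod n K) \<and>
                   (\<forall>K. finite {a \<in> Aprod n K. x a \<noteq> 0})}"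

text \<open>Here \<open>\<lambda>m. tpow (Nform n M (m - M)) * y (m - M)\<close> is the product of \<open>:M:\<close> and \<open>y\<close>.\<close>

definition Yt_inf :: "nat \<Rightarrow> (mono \<Rightarrow> laurent) set" where
  "Yt_inf n = {\<lambda>m. \<Sum>M\<in>S. tpow (Nform n M (m - M)) * y M (m - M) | S y.
                 finite S \<and> S \<subseteq> Mon n \<and> (\<forall>M\<in>S. y M \<in> YtA_inf n)}"

text \<open>The elements \<open>\<Sum>\<^sub>K \<Sum>\<^sub>a \<lambda>\<^sub>a(t) E\<^bsub>i,t\<^esub>(M a)\<close> for a fixed \<open>M\<close>: the function \<open>c K\<close> holds the
  coefficients \<open>\<lambda>\<^sub>a\<close> for the products \<open>a\<close> of \<open>K\<close> factors. The sum over \<open>K\<close> is taken coefficientwise.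
  A given monomial has a nonzero coefficient for finitely many \<open>K\<close> only, so \<open>Sum_any\<close> is a
  genuine sum.\<close>

definition Kit_block :: "nat \<Rightarrow> nat \<Rightarrow> mono \<Rightarrow> (mono \<Rightarrow> laurent) set" where
  "Kit_block n i M =
     {\<lambda>m. Sum_any (\<lambda>K::nat. \<Sum>a\<in>Poly_Mapping.keys (c K).
            Poly_Mapping.lookup (c K) a * Poly_Mapping.lookup (Eit n i (M + a)) m)
      | c :: nat \<Rightarrow> (mono \<Rightarrow>\<^sub>0 laurent).
        \<forall>K. Poly_Mapping.keys (c K) \<subseteq> {a \<in> Aprod n K. M + a \<in> dominant n {i}}}"

definition Kit_inf :: "nat \<Rightarrow> nat \<Rightarrow> (mono \<Rightarrow> laurent) set" where
  "Kit_inf n i = {\<lambda>m. \<Sum>M\<in>S. x M m | S x.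
                    finite S \<and> S \<subseteq> Mon n \<and> (\<forall>M\<in>S. x M \<in> Kit_block n i M)}"

definition Kt_inf :: "nat \<Rightarrow> (mono \<Rightarrow> laurent) set" where
  "Kt_inf n = (\<Inter>i\<in>Idx n. Kit_inf n i)"

section \<open>The sets \<open>D\<^sub>m\<close>\<close>

definition Ypol :: "nat \<Rightarrow> int \<Rightarrow> (mono \<Rightarrow>\<^sub>0 int)" where
  "Ypol i l = Poly_Mapping.single (Ymon i l) 1"

inductive_set Ki :: "nat \<Rightarrow> nat \<Rightarrow> (mono \<Rightarrow>\<^sub>0 int) set" for n i where
  gen_i: "Ypol i l * (1 + Poly_Mapping.single (- Amon n i (l + 1)) 1) \<in> Ki n i"
| gen_j: "j \<in> Idx n \<Longrightarrow> j \<noteq> i \<Longrightarrow> Ypol j l \<in> Ki n i"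
| gen_j_inv: "j \<in> Idx n \<Longrightarrow> j \<noteq> i \<Longrightarrow> Poly_Mapping.single (- Ymon j l) 1 \<in> Ki n i"
| one: "1 \<in> Ki n i"
| diff: "x \<in> Ki n i \<Longrightarrow> y \<in> Ki n i \<Longrightarrow> x - y \<in> Ki n i"
| mult: "x \<in> Ki n i \<Longrightarrow> y \<in> Ki n i \<Longrightarrow> x * y \<in> Ki n i"

definition KJ :: "nat \<Rightarrow> nat set \<Rightarrow> (mono \<Rightarrow>\<^sub>0 int) set" where
  "KJ n J = {x. Poly_Mapping.keys x \<subseteq> Mon n \<and> (\<forall>i\<in>J. x \<in> Ki n i)}"

definition EJ_Y :: "nat \<Rightarrow> nat set \<Rightarrow> nat \<Rightarrow> int \<Rightarrow> (mono \<Rightarrow>\<^sub>0 int)" where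
  "EJ_Y n J j l = (THE x. x \<in> KJ n J \<and>
      Poly_Mapping.keys x \<inter> dominant n J = {Ymon j l} \<and>
      Poly_Mapping.lookup x (Ymon j l) = 1)"

text \<open>For \<open>m \<in> dominant n J\<close> the exponents at indices in \<open>J\<close> are nonnegative.\<close>

definition EJ :: "nat \<Rightarrow> nat set \<Rightarrow> mono \<Rightarrow> (mono \<Rightarrow>\<^sub>0 int)" where
  "EJ n J m =
     Poly_Mapping.single
       (\<Sum>p\<in>{p \<in> Poly_Mapping.keys m. fst p \<notin> J}.
          Poly_Mapping.single p (Poly_Mapping.lookup m p)) 1
     * (\<Prod>p\<in>{p \<in> Poly_Mapping.keys m. fst p \<in> J}.
          EJ_Y n J (fst p) (snd p) ^ nat (Poly_Mapping.lookup m p))"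

text \<open>The finite sequence \<open>(m\<^sub>0, \<dots>, m\<^sub>R)\<close> is given by the values of \<open>s\<close> on \<open>{0..R}\<close>.\<close>

definition Dset :: "nat \<Rightarrow> mono \<Rightarrow> mono set" where
  "Dset n m = {m' \<in> Mon n. \<exists>(R::nat) (s :: nat \<Rightarrow> mono).
      (\<forall>r\<le>R. s r \<in> Mon n) \<and> s 0 = m \<and> s R = m' \<and>
      (\<forall>r\<in>{1..R}. \<exists>r'<r. \<exists>J\<subseteq>Idx n. s r' \<in> dominant n J \<and>
         (\<forall>r''\<in>{r'<..r}. s r'' \<in> Poly_Mapping.keys (EJ n J (s r')) \<and>
            s r'' - s (r'' - 1) \<in> {- Amon n j l | j l. j \<in> J}))}"

definition Dtilde :: "nat \<Rightarrow> mono \<Rightarrow> (mono \<Rightarrow> laurent) set" where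
  "Dtilde n m = {x \<in> Yt_inf n. \<forall>m'. x m' \<noteq> 0 \<longrightarrow> m' \<in> Dset n m}"

section \<open>\<open>q,t\<close>-characters of fundamental representations\<close>

definition is_Ft :: "nat \<Rightarrow> nat \<Rightarrow> (mono \<Rightarrow> laurent) \<Rightarrow> bool" where
  "is_Ft n i F \<longleftrightarrow> F \<in> Kt_inf n \<inter> Dtilde n (Ymon i 0) \<and>
     {m \<in> dominant n (Idx n). F m \<noteq> 0} = {Ymon i 0} \<and> F (Ymon i 0) = 1"

definition Ft :: "nat \<Rightarrow> nat \<Rightarrow> (mono \<Rightarrow> laurent)" where
  "Ft n i = (THE F. is_Ft n i F)"

end

(*
  An element of the intersection of the completed kernels is determined by its dominant
  monomials: in an expansion over the E_{i,t}(m) nothing cancels in maximal height, so a maximal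
  monomial of the support is i-dominant for every i. Hence it suffices to exhibit one element with
  Y_{i,0} as its only dominant monomial. Such an element is the sum of the :m_T: over the columns
  T, i.e. the i-element subsets of {1, ..., n + 1}. For each direction p these monomials are either
  free of Y_p or come in pairs m, m A_{p,l+1}^{-1} with m containing a single Y_{p,l}; since
  pairing with A_{p,l} only sees Y_{p,l-1} and Y_{p,l+1}, the powers of t in E_{p,t}(m) agree
  on both members of a pair, so every coefficient is 1.
*)
theory Submission
  imports Defs
begin

section \<open>The inverse quantized Cartan matrix\<close>

text \<open>Two definite descriptions must be pinned down before anything can be computed.
  \<open>Cz_inv\<close> is an inverse in a matrix ring, so \<open>Cz n\<close> must first be shown
  invertible over series with integer coefficients; the quantum integers do this because [n+1] has
  leading coefficient 1. \<open>Ft\<close> gets its uniqueness from the comparison with the column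
  sum. The comparison is made in \<open>expansion\<close>, a form that holds for both sides and is
  closed under differences. Expansions may be infinite, so a maximal monomial is not automatic:
  \<open>height\<close> drops by 2 with every A_{j,l}^{-1}, and only finitely many coefficients lie
  above any given height. The powers of t in E_{i,t}(m) come from an ordered product in a
  noncommutative algebra and from inverses taken there, and are left undetermined. A unit cannot
  kill a leading term, and in the expansion of the column sum it is absorbed into the coefficient.
  What matters is that both members of a pair carry the same power.\<close>

text \<open>The quantum integer \<open>[k] = (z\<^sup>k - z\<^sup>-\<^sup>k) / (z - z\<^sup>-\<^sup>1)\<close>.\<close>

fun qint :: "nat \<Rightarrow> int fls" where
  "qint 0 = 0"
| "qint (Suc 0) = 1"
| "qint (Suc (Suc k)) = (fls_X_inv + fls_X) * qint (Suc k) - qint k"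

text \<open>For fixed \<open>b\<close> both sides satisfy the defining three-term recursion in
  \<open>a\<close>. The formula evaluates the diagonal of C(z) times its candidate inverse.\<close>

lemma qint_addition: "qint (Suc a) * qint (Suc b) - qint a * qint b = qint (Suc (a + b))"
proof (induction a rule: qint.induct)
  case (3 k)
  define z :: "int fls" where "z = fls_X_inv + fls_X"
  have rec: "qint (Suc (Suc m)) = z * qint (Suc m) - qint m" for m
    by (simp add: z_def)
  have "qint (Suc (Suc (Suc k))) * qint (Suc b) - qint (Suc (Suc k)) * qint b
      = z * (qint (Suc (Suc k)) * qint (Suc b) - qint (Suc k) * qint b)
        - (qint (Suc k) * qint (Suc b) - qint k * qint b)"
    unfolding rec by (simp add: algebra_simps)
  also have "\<dots> = z * qint (Suc (Suc (k + b))) - qint (Suc (k + b))"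
    using 3 by (simp del: qint.simps)
  also have "\<dots> = qint (Suc (Suc (Suc k) + b))"
    by (simp add: rec del: qint.simps)
  finally show ?case .
qed simp_all

text \<open>In X = z^-1 the lowest term of [k+1] is X^-k. Integer coefficients leave few units, so
  it matters that its coefficient is 1.\<close>

lemma qint_leading:
  "fls_nth (qint (Suc k)) (- int k) = 1 \<and> (\<forall>r < - int k. fls_nth (qint (Suc k)) r = 0)"
proof (induction k rule: qint.induct)
  case 1 then show ?case by simp
next
  case 2 then show ?case by (auto simp: distrib_right fls_X_times_conv_shift
      fls_X_inv_times_conv_shift)
next
  case (3 k)
  then show ?case 
   by (auto simp: distrib_right fls_X_times_conv_shift fls_X_inv_times_conv_shift algebra_simps)
qed

lemma qint_unit:
  obtains V where "V * qint (Suc k) = 1"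
proof -
  let ?f = "qint (Suc k)"
  have "fls_nth ?f (- int k) = 1" "\<forall>r < - int k. fls_nth ?f r = 0" using qint_leading by auto
  then have "fls_subdegree ?f = - int k" 
    by (intro fls_subdegree_eqI) auto
  \<comment> \<open>The argument 1 of \<open>fls_right_inverse\<close> is the inverse of the lowest
    coefficient.\<close>
  then have "?f * fls_right_inverse ?f 1 = 1"
    using qint_leading[of k] by (intro fls_right_inverse) auto
  then show ?thesis using that by (metis mult.commute)
qed

definition nbs :: "nat \<Rightarrow> nat \<Rightarrow> nat set" where
  "nbs n p = {j \<in> Idx n. \<bar>int j - int p\<bar> = 1}"

lemma nbs_eq: "nbs n p = {p - 1, Suc p} \<inter> Idx n - {p}"
  unfolding nbs_def Idx_def by auto

lemma finite_nbs [simp]: "finite (nbs n p)"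
  by (simp add: nbs_eq)

lemma finite_Idx [simp]: "finite (Idx n)"
  by (simp add: Idx_def)

text \<open>The boundary conditions at 0 and n + 1 absorb the missing neighbours of the end nodes.
  Both \<open>Cz_inv_entry\<close> and the weight in \<open>height\<close> satisfy them.\<close>

lemma sum_nbs:
  fixes f :: "nat \<Rightarrow> 'a :: comm_monoid_add"
  assumes "p \<in> Idx n" "f 0 = 0" "f (Suc n) = 0"
  shows "(\<Sum>j\<in>nbs n p. f j) = f (p - 1) + f (Suc p)"
proof -
  have "(\<Sum>j\<in>nbs n p. f j) = (\<Sum>j\<in>{p - 1, Suc p}. f j)"
    using assms by (intro sum.mono_neutral_left) (auto simp: nbs_def Idx_def, 
       (metis le_Suc_eq not_less_eq_eq One_nat_def le_numeral_extra(4) le_zero_eq not_less_eq_eq)+)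
  then show ?thesis using assms(1) by (simp add: Idx_def)
qed

text \<open>Bridges two index conventions: matrix rows start at 0, Dynkin nodes at 1.\<close>

lemma cartan_row_sum:
  fixes z :: "'a :: comm_ring_1"
  assumes "a < n"
  shows "(\<Sum>k<n. (if a = k then z else if \<bar>int a - int k\<bar> = 1 then - 1 else 0) * f (Suc k))
       = z * f (Suc a) - (\<Sum>j\<in>nbs n (Suc a). f j)"
proof -
  have "(\<Sum>k<n. (if a = k then z else if \<bar>int a - int k\<bar> = 1 then - 1 else 0) * f (Suc k))
      = (\<Sum>k<n. (if k = a then z * f (Suc k) else 0) - (if \<bar>int a - int k\<bar>
          = 1 then f (Suc k) else 0))"
    by (intro sum.cong) auto
  also have "\<dots> = z * f (Suc a) - (\<Sum>k<n. if \<bar>int a - int k\<bar> = 1 then f (Suc k) else 0)"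
    using assms by (simp add: sum_subtractf)
  also have "(\<Sum>k<n. if \<bar>int a - int k\<bar> = 1 then f (Suc k) else 0)
      = (\<Sum>k\<in>{k \<in> {..<n}. \<bar>int a - int k\<bar> = 1}. f (Suc k))"
    by (intro sum.inter_filter [symmetric]) simp
  also have "\<dots> = (\<Sum>j\<in>nbs n (Suc a). f j)"
    by (rule sum.reindex_bij_witness [of _ "\<lambda>j. j - 1" Suc]) (auto simp: nbs_def Idx_def)
  finally show ?thesis .
qed

text \<open>For \<open>V = 1 / [n + 1]\<close> these are the entries of the inverse of \<open>C(z)\<close>.\<close>

definition Cz_inv_entry :: "nat \<Rightarrow> int fls \<Rightarrow> nat \<Rightarrow> nat \<Rightarrow> int fls" where
  "Cz_inv_entry n V i j = V * qint (min i j) * qint (Suc n - max i j)"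

lemma Cz_inv_entry_sym: "Cz_inv_entry n V i j = Cz_inv_entry n V j i"
  by (simp add: Cz_inv_entry_def min.commute max.commute)

text \<open>On either side of j the entry is a constant times [q] or [n+1-q], so the recursion gives
  0. At p = j, with a = p - 1 and b = n - p, the addition formula gives V [n+1] = 1.\<close>

lemma Cz_inv_entry_row:
  assumes "V * qint (Suc n) = 1" "p \<in> Idx n" "j \<in> Idx n"
  shows "(fls_X_inv + fls_X) * Cz_inv_entry n V p j - (\<Sum>q\<in>nbs n p. Cz_inv_entry n V q j) = (if p
      = j then 1 else 0)"
proof -
  define z :: "int fls" where "z = fls_X_inv + fls_X"
  have rec: "qint (Suc (Suc m)) = z * qint (Suc m) - qint m" for m
    by (simp add: z_def)
  obtain a where a: "p = Suc a" using assms(2) by (cases p) (auto simp: Idx_def)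
  obtain b where b: "n = p + b" using assms(2) by (auto simp: Idx_def le_iff_add)
  have "(\<Sum>q\<in>nbs n p. Cz_inv_entry n V q j) = Cz_inv_entry n V (p - 1) j
      + Cz_inv_entry n V (Suc p) j"
    using assms by (intro sum_nbs) (auto simp: Cz_inv_entry_def Idx_def)
  moreover have "z * Cz_inv_entry n V p j - (Cz_inv_entry n V (p - 1) j
      + Cz_inv_entry n V (Suc p) j) = (if p = j then 1 else 0)"
  proof (cases p j rule: linorder_cases)
    case less
    have "Cz_inv_entry n V q j = (V * qint (Suc n - j)) * qint q" if "q \<le> Suc p" for q
      using that less by (simp add: Cz_inv_entry_def min_def max_def)
    then show ?thesis using less by (simp add: a rec algebra_simps del: qint.simps)
  next
    case greater
    have "Cz_inv_entry n V q j = (V * qint j) * qint (Suc n - q)" if "q \<ge> p - 1" for q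
      using that greater by (cases "q = j") (simp_all add: Cz_inv_entry_def min_def max_def)
    then show ?thesis using greater a b
      by (simp add: Suc_diff_le rec algebra_simps del: qint.simps)
  next
    case equal
    have "z * Cz_inv_entry n V p j - (Cz_inv_entry n V (p - 1) j + Cz_inv_entry n V (Suc p) j)
       = V * (z * qint (Suc a) * qint (Suc b) - qint a * qint (Suc b) - qint (Suc a) * qint b)"
      unfolding equal [symmetric] b unfolding a
      by (simp add: Cz_inv_entry_def algebra_simps del: qint.simps)
    also have "\<dots> = V * (qint (Suc (Suc a)) * qint (Suc b) - qint (Suc a) * qint b)"
      by (simp add: rec algebra_simps del: qint.simps)
    also have "\<dots> = 1"
      using assms(1) a b by (simp add: qint_addition del: qint.simps)
    finally show ?thesis using equal by simp
  qed
  ultimately show ?thesis by (simp add: z_def)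
qed

text \<open>\<open>Cz_inv\<close> has no usable value until \<open>Cz n\<close> is known to be a
  unit of the matrix ring; \<open>G\<close> is the witness. One row identity yields both products
  since \<open>Cz n\<close> and \<open>G\<close> are symmetric.\<close>

lemma Cz_inv_inverse:
  shows "Cz_inv n \<in> carrier_mat n n" "Cz_inv n * Cz n = 1\<^sub>m n" "Cz n * Cz_inv n = 1\<^sub>m n"
proof -
  let ?R = "ring_mat TYPE(int fls) n ()"
  interpret semiring ?R by (rule semiring_mat)
  obtain V where V: "V * qint (Suc n) = 1" by (rule qint_unit)
  define G where "G = mat n n (\<lambda>(a, b). Cz_inv_entry n V (Suc a) (Suc b))"
  have C: "Cz n \<in> carrier_mat n n" and G: "G \<in> carrier_mat n n"
    by (simp_all add: Cz_def G_def)
  have CG: "(\<Sum>k<n. (if a = k then fls_X_inv + fls_X else if \<bar>int a - int k\<bar> = 1 then - 1 else 0)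
          * Cz_inv_entry n V (Suc k) (Suc b)) = (if a = b then 1 else 0)" if "a < n" "b < n" for a b
    using that Cz_inv_entry_row[OF V, of "Suc a" "Suc b"]
    by (subst cartan_row_sum) (auto simp: Idx_def)
  have "Cz n * G = 1\<^sub>m n"
    using CG by (intro eq_matI) (auto simp: Cz_def G_def scalar_prod_def atLeast0LessThan)
  moreover have "G * Cz n = 1\<^sub>m n"
  proof (intro eq_matI)
    fix a b assume "a < dim_row (1\<^sub>m n :: int fls mat)" "b < dim_col (1\<^sub>m n :: int fls mat)"
    then have ab: "a < n" "b < n" by auto
    have "(G * Cz n) $$ (a, b) = (\<Sum>k<n. Cz_inv_entry n V (Suc a) (Suc k) * 
       (if k = b then fls_X_inv + fls_X else if \<bar>int k - int b\<bar> = 1 then - 1 else 0))"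
      using ab by (simp add: Cz_def G_def scalar_prod_def atLeast0LessThan)
    also have "\<dots> = (\<Sum>k<n. (if b = k then fls_X_inv + fls_X else
        if \<bar>int b - int k\<bar> = 1 then - 1 else 0)
          * Cz_inv_entry n V (Suc k) (Suc a))"
      by (intro sum.cong) (auto simp: Cz_inv_entry_sym abs_minus_commute)
    finally show "(G * Cz n) $$ (a, b) = 1\<^sub>m n $$ (a, b)" using CG[OF ab(2,1)] ab by simp
  qed (simp_all add: G_def Cz_def)
  ultimately have U: "Cz n \<in> Units ?R"
    using C G by (auto simp: Units_def ring_mat_simps)
  show "Cz_inv n \<in> carrier_mat n n" "Cz_inv n * Cz n = 1\<^sub>m n" "Cz n * Cz_inv n = 1\<^sub>m n"
    using Units_inv_closed[OF U] Units_l_inv[OF U] Units_r_inv[OF U]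
    by (simp_all add: Cz_inv_def ring_mat_simps)
qed

lemma fls_nth_Cartan_diag:
  "fls_nth ((fls_X_inv + fls_X) * f) (- r) = fls_nth f (- (r - 1)) + fls_nth f (- (r + 1))"
  for f :: "int fls"
  by (simp add: distrib_right fls_X_times_conv_shift fls_X_inv_times_conv_shift)

text \<open>The two orders of multiplication serve the two arguments of the bicharacter: these are
  the coefficients of z^r in C~ C = 1 and C C~ = 1.\<close>

lemma
  assumes "p \<in> Idx n" "j \<in> Idx n"
  shows Ctilde_times_Cartan: "Ctilde n j p (r - 1) + Ctilde n j p (r
      + 1) - (\<Sum>q\<in>nbs n p. Ctilde n j q r)
       = (if j = p \<and> r = 0 then 1 else 0)"
    and Cartan_times_Ctilde: "Ctilde n p j (r - 1) + Ctilde n p j (r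
        + 1) - (\<Sum>q\<in>nbs n p. Ctilde n q j r)
       = (if j = p \<and> r = 0 then 1 else 0)"
proof -
  obtain a b where ab: "p = Suc a" "j = Suc b" "a < n" "b < n"
    using assms by (cases p; cases j) (auto simp: Idx_def)
  let ?G = "Cz_inv n"
  have dim [simp]: "dim_row ?G = n" "dim_col ?G = n" using Cz_inv_inverse(1)[of n] by auto
  have one: "fls_nth (if a = b then 1 else 0 :: int fls) (- r) = (if j = p \<and> r = 0 then 1 else 0)"
    by (auto simp: ab)
  have nth_sum: "fls_nth (\<Sum>q\<in>S. F q) s = (\<Sum>q\<in>S. fls_nth (F q) s)" for S and F :: "nat \<Rightarrow> int fls"
      and s
    by (induction S rule: infinite_finite_induct) auto
  have "(if a = b then 1 else 0) = (?G * Cz n) $$ (b, a)"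
    using Cz_inv_inverse(2)[of n] ab by simp
  also have "\<dots> = (\<Sum>k<n. ?G $$ (b, k) * Cz n $$ (k, a))"
    using ab by (simp add: scalar_prod_def atLeast0LessThan Cz_def)
  also have "\<dots> = (\<Sum>k<n. (if a = k then fls_X_inv + fls_X else
      if \<bar>int a - int k\<bar> = 1 then - 1 else 0)
          * ?G $$ (b, Suc k - 1))"
    using ab by (intro sum.cong) (auto simp: Cz_def)
  also have "\<dots> = (fls_X_inv + fls_X) * ?G $$ (b, Suc a - 1) - (\<Sum>q\<in>nbs n (Suc a). ?G $$ (b, q - 1))"
    using ab by (intro cartan_row_sum)
  finally have "fls_nth (if a = b then 1 else 0 :: int fls) (- r) = fls_nth \<dots> (- r)" by simp
  then show "Ctilde n j p (r - 1) + Ctilde n j p (r + 1) - (\<Sum>q\<in>nbs n p. Ctilde n j q r)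
       = (if j = p \<and> r = 0 then 1 else 0)"
    unfolding one fls_minus_nth fls_nth_Cartan_diag nth_sum by (simp add: Ctilde_def ab)
  have "(if a = b then 1 else 0) = (Cz n * ?G) $$ (a, b)"
    using Cz_inv_inverse(3)[of n] ab by simp
  also have "\<dots> = (\<Sum>k<n. Cz n $$ (a, k) * ?G $$ (k, b))"
    using ab by (simp add: scalar_prod_def atLeast0LessThan Cz_def)
  also have "\<dots> = (\<Sum>k<n. (if a = k then fls_X_inv + fls_X else
      if \<bar>int a - int k\<bar> = 1 then - 1 else 0)
          * ?G $$ (Suc k - 1, b))"
    using ab by (intro sum.cong) (auto simp: Cz_def)
  also have "\<dots> = (fls_X_inv + fls_X) * ?G $$ (Suc a - 1, b) - (\<Sum>q\<in>nbs n (Suc a). ?G $$ (q - 1, b))"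
    using ab by (intro cartan_row_sum [where f = "\<lambda>q. ?G $$ (q - 1, b)"])
  finally have "fls_nth (if a = b then 1 else 0 :: int fls) (- r) = fls_nth \<dots> (- r)" by simp
  then show "Ctilde n p j (r - 1) + Ctilde n p j (r + 1) - (\<Sum>q\<in>nbs n p. Ctilde n q j r)
       = (if j = p \<and> r = 0 then 1 else 0)"
    unfolding one fls_minus_nth fls_nth_Cartan_diag nth_sum by (simp add: Ctilde_def ab)
qed

section \<open>The bicharacter and the height\<close>

definition linext :: "('a \<Rightarrow> int) \<Rightarrow> ('a \<Rightarrow>\<^sub>0 int) \<Rightarrow> int" where
  "linext w m = (\<Sum>x\<in>Poly_Mapping.keys m. Poly_Mapping.lookup m x * w x)"

lemma linext_superset:
  assumes "finite S" "Poly_Mapping.keys m \<subseteq> S"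
  shows "linext w m = (\<Sum>x\<in>S. Poly_Mapping.lookup m x * w x)"
  unfolding linext_def using assms by (intro sum.mono_neutral_left) (auto simp: in_keys_iff)

lemma linext_zero [simp]: "linext w 0 = 0"
  by (simp add: linext_def)

lemma linext_add: "linext w (m + m') = linext w m + linext w m'"
proof -
  let ?S = "Poly_Mapping.keys m \<union> Poly_Mapping.keys m'"
  have "linext w (m + m') = (\<Sum>x\<in>?S. Poly_Mapping.lookup (m + m') x * w x)"
    by (intro linext_superset) (simp_all add: keys_add)
  also have "\<dots> = (\<Sum>x\<in>?S. Poly_Mapping.lookup m x * w x) + (\<Sum>x\<in>?S. Poly_Mapping.lookup m' x * w x)"
    by (simp add: lookup_add distrib_right sum.distrib)
  also have "\<dots> = linext w m + linext w m'"
    by (simp add: linext_superset [of ?S])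
  finally show ?thesis .
qed

lemma linext_uminus: "linext w (- m) = - linext w m"
  using linext_add [of w m "- m"] by simp

lemma linext_diff: "linext w (m - m') = linext w m - linext w m'"
  using linext_add [of w m "- m'"] by (simp add: linext_uminus)

lemma linext_sum: "linext w (\<Sum>x\<in>S. f x) = (\<Sum>x\<in>S. linext w (f x))"
  by (induction S rule: infinite_finite_induct) (simp_all add: linext_add)

lemma linext_single [simp]: "linext w (Poly_Mapping.single x c) = c * w x"
  by (simp add: linext_def)

lemma linext_add_fun: "linext (\<lambda>x. w x + w' x) m = linext w m + linext w' m"
  by (simp add: linext_def distrib_left sum.distrib)

lemma linext_uminus_fun: "linext (\<lambda>x. - w x) m = - linext w m"
  by (simp add: linext_def sum_negf)

lemma linext_indicator: "linext (\<lambda>x. if x = y then 1 else 0) m = Poly_Mapping.lookup m y"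
proof -
  let ?S = "insert y (Poly_Mapping.keys m)"
  have "linext (\<lambda>x. if x = y then 1 else 0) m
      = (\<Sum>x\<in>?S. Poly_Mapping.lookup m x * (if x = y then 1 else 0))"
    by (intro linext_superset) auto
  also have "\<dots> = (\<Sum>x\<in>?S. if x = y then Poly_Mapping.lookup m x else 0)"
    by (intro sum.cong) auto
  finally show ?thesis by simp
qed

definition Ypair :: "nat \<Rightarrow> nat \<times> int \<Rightarrow> nat \<times> int \<Rightarrow> int" where
  "Ypair n x y = Ctilde n (fst y) (fst x) (1 + snd x - snd y)
     - Ctilde n (fst y) (fst x) (- 1 + snd x - snd y)"

lemma Nform_linext: "Nform n m1 m2 = linext (\<lambda>x. linext (Ypair n x) m2) m1"
  unfolding Nform_def linext_def Ypair_def
  by (auto intro!: sum.cong simp: sum_distrib_left mult.assoc split_beta)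

lemma Nform_add_right: "Nform n c (a + b) = Nform n c a + Nform n c b"
  by (simp add: Nform_linext linext_add linext_add_fun)

lemma Nform_uminus_left: "Nform n (- a) c = - Nform n a c"
  by (simp add: Nform_linext linext_uminus)

lemma Nform_uminus_right: "Nform n c (- a) = - Nform n c a"
  by (simp add: Nform_linext linext_uminus linext_uminus_fun)

lemma Nform_diff_left: "Nform n (a - b) c = Nform n a c - Nform n b c"
  by (simp add: Nform_linext linext_diff)

lemma Nform_diff_right: "Nform n c (a - b) = Nform n c a - Nform n c b"
  using Nform_add_right [of n c a "- b"] by (simp add: Nform_uminus_right)

lemma Nform_zero_right [simp]: "Nform n c 0 = 0"
  by (simp add: Nform_def)

lemma Amon_nbs: "Amon n p l = Ymon p (l - 1) + Ymon p (l + 1) - (\<Sum>j\<in>nbs n p. Ymon j l)"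
  by (simp add: Amon_def nbs_def)

lemma linext_Amon: "linext w (Amon n p l) = w (p, l - 1) + w (p, l + 1) - (\<Sum>j\<in>nbs n p. w (j, l))"
  by (simp add: Amon_nbs linext_add linext_diff linext_sum Ymon_def)

lemma linext_cong_Mon:
  assumes "m \<in> Mon n" "\<And>j k. j \<in> Idx n \<Longrightarrow> w (j, k) = w' (j, k)"
  shows "linext w m = linext w' m"
  unfolding linext_def using assms by (intro sum.cong) (auto simp: Mon_def)

text \<open>Since \<open>Ypair\<close> is the difference of two shifted entries of \<open>Ctilde\<close>, pairing with
  \<open>A\<^bsub>p,l\<^esub>\<close> multiplies \<open>Ctilde\<close> by \<open>C(z)\<close> and only two Kronecker deltas survive.\<close>

lemma Nform_Amon_left:
  assumes "m \<in> Mon n" "p \<in> Idx n"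
  shows "Nform n (Amon n p l) m = Poly_Mapping.lookup m (p, l
      + 1) - Poly_Mapping.lookup m (p, l - 1)"
proof -
  have pt: "linext (\<lambda>x. Ypair n x (j, k)) (Amon n p l)
      = (if (j, k) = (p, l + 1) then 1 else 0) + - (if (j, k) = (p, l - 1) then 1 else 0)"
    if "j \<in> Idx n" for j k
    using Ctilde_times_Cartan [OF assms(2) that, of "l - k + 1"]
      Ctilde_times_Cartan [OF assms(2) that, of "l - k - 1"]
    by (auto simp: linext_Amon Ypair_def sum_subtractf algebra_simps split: if_splits)
  have "Nform n (Amon n p l) m = linext (\<lambda>y. linext (\<lambda>x. Ypair n x y) (Amon n p l)) m"
    unfolding Nform_linext by (simp add: linext_def sum_distrib_left sum.swap [of _ _
        "Poly_Mapping.keys m"] mult.left_commute)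
  also have "\<dots> = linext (\<lambda>y. (if y = (p, l + 1) then 1 else 0) + - (if y
      = (p, l - 1) then 1 else 0)) m"
    by (intro linext_cong_Mon [OF assms(1)] pt)
  also have "\<dots> = Poly_Mapping.lookup m (p, l + 1) - Poly_Mapping.lookup m (p, l - 1)"
    by (subst linext_add_fun, subst linext_uminus_fun) (simp add: linext_indicator)
  finally show ?thesis .
qed

text \<open>The sign is opposite to that of \<open>Nform_Amon_left\<close> because
  \<open>Ypair\<close> depends on the difference of the levels, and here A_{p,l} supplies the
  subtracted one.\<close>

lemma Nform_Amon_right:
  assumes "m \<in> Mon n" "p \<in> Idx n"
  shows "Nform n m (Amon n p l) = Poly_Mapping.lookup m (p, l - 1) - Poly_Mapping.lookup m (p, l
      + 1)"
proof -
  have pt: "linext (Ypair n (j, k)) (Amon n p l)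
      = (if (j, k) = (p, l - 1) then 1 else 0) + - (if (j, k) = (p, l + 1) then 1 else 0)"
    if "j \<in> Idx n" for j k
    using Cartan_times_Ctilde [OF assms(2) that, of "k - l + 1"]
      Cartan_times_Ctilde [OF assms(2) that, of "k - l - 1"]
    by (auto simp: linext_Amon Ypair_def sum_subtractf algebra_simps split: if_splits)
  have "Nform n m (Amon n p l) = linext (\<lambda>y. (if y = (p, l - 1) then 1 else 0) + - (if y
      = (p, l + 1) then 1 else 0)) m"
    unfolding Nform_linext by (intro linext_cong_Mon [OF assms(1)] pt)
  also have "\<dots> = Poly_Mapping.lookup m (p, l - 1) - Poly_Mapping.lookup m (p, l + 1)"
    by (subst linext_add_fun, subst linext_uminus_fun) (simp add: linext_indicator)
  finally show ?thesis .
qed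

text \<open>The weight \<open>j (n + 1 - j)\<close> has constant second difference \<open>-2\<close> and vanishes at \<open>0\<close> and
  \<open>n + 1\<close>, so all \<open>A\<^bsub>p,l\<^esub>\<close> have the same height.\<close>

definition height :: "nat \<Rightarrow> mono \<Rightarrow> int" where
  "height n = linext (\<lambda>(j, l). int j * (int n + 1 - int j))"

lemma height_add: "height n (a + b) = height n a + height n b"
  by (simp add: height_def linext_add)

lemma height_diff: "height n (a - b) = height n a - height n b"
  by (simp add: height_def linext_diff)

lemma height_uminus: "height n (- a) = - height n a"
  by (simp add: height_def linext_uminus)

lemma height_zero [simp]: "height n 0 = 0"
  by (simp add: height_def)

lemma height_Amon:
  assumes "p \<in> Idx n"
  shows "height n (Amon n p l) = 2"
proof -
  define w where "w j = int j * (int n + 1 - int j)" for j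
  have "height n (Amon n p l) = 2 * w p - (\<Sum>j\<in>nbs n p. w j)"
    by (simp add: height_def linext_Amon w_def)
  also have "(\<Sum>j\<in>nbs n p. w j) = w (p - 1) + w (Suc p)"
    using assms by (intro sum_nbs) (simp_all add: w_def)
  also have "2 * w p - (w (p - 1) + w (Suc p)) = 2"
    using assms by (cases p) (auto simp: w_def Idx_def algebra_simps)
  finally show ?thesis .
qed

lemma Mon_zero [simp]: "0 \<in> Mon n"
  by (simp add: Mon_def)

lemma Mon_uminus [simp]: "- m \<in> Mon n \<longleftrightarrow> m \<in> Mon n"
  by (simp add: Mon_def)

lemma Mon_add: "a \<in> Mon n \<Longrightarrow> b \<in> Mon n \<Longrightarrow> a + b \<in> Mon n"
  using keys_add [of a b] by (auto simp: Mon_def)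

lemma Mon_sum: "(\<And>x. x \<in> S \<Longrightarrow> f x \<in> Mon n) \<Longrightarrow> (\<Sum>x\<in>S. f x) \<in> Mon n"
  by (induction S rule: infinite_finite_induct) (auto intro: Mon_add)

lemma Mon_single: "j \<in> Idx n \<Longrightarrow> Poly_Mapping.single (j, l) c \<in> Mon n"
  by (simp add: Mon_def)

lemma Mon_Ymon: "j \<in> Idx n \<Longrightarrow> Ymon j l \<in> Mon n"
  by (simp add: Ymon_def Mon_single)

section \<open>The elements \<open>E\<^bsub>i,t\<^esub>(m)\<close>\<close>

lemma tpow_mult: "tpow a * tpow b = tpow (a + b)"
  by (simp add: mult_single)

lemma tpow_cancel: "tpow (- a) * (tpow a * x) = x"
  by (simp add: mult.assoc [symmetric] tpow_mult)

lemma one_Yt: "\<one>\<^bsub>Yt n\<^esub> = Poly_Mapping.single 0 (tpow 0)"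
  by (simp add: Yt_def bas_def)

text \<open>Keys can disappear in a sum by cancellation; summing over a common superset makes
  distributivity immediate.\<close>

lemma Yt_mult_superset:
  assumes "finite S" "Poly_Mapping.keys x \<subseteq> S" "finite S'" "Poly_Mapping.keys y \<subseteq> S'"
  shows "x \<otimes>\<^bsub>Yt n\<^esub> y = (\<Sum>m1\<in>S. \<Sum>m2\<in>S'. Poly_Mapping.single (m1 + m2)
           (tpow (Nform n m1 m2) * Poly_Mapping.lookup x m1 * Poly_Mapping.lookup y m2))"
proof -
  have "x \<otimes>\<^bsub>Yt n\<^esub> y = (\<Sum>m1\<in>Poly_Mapping.keys x. \<Sum>m2\<in>S'. Poly_Mapping.single (m1 + m2)
           (tpow (Nform n m1 m2) * Poly_Mapping.lookup x m1 * Poly_Mapping.lookup y m2))"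
    unfolding Yt_def monoid.simps ring.simps
    by (rule sum.cong [OF refl], rule sum.mono_neutral_left) (use assms in \<open>auto simp: in_keys_iff\<close>)
  also have "\<dots> = (\<Sum>m1\<in>S. \<Sum>m2\<in>S'. Poly_Mapping.single (m1 + m2)
           (tpow (Nform n m1 m2) * Poly_Mapping.lookup x m1 * Poly_Mapping.lookup y m2))"
    using assms by (intro sum.mono_neutral_left) (auto simp: in_keys_iff)
  finally show ?thesis .
qed

lemma Yt_mult_single:
  "Poly_Mapping.single a c \<otimes>\<^bsub>Yt n\<^esub> Poly_Mapping.single b d
     = Poly_Mapping.single (a + b) (tpow (Nform n a b) * c * d)"
  by (subst Yt_mult_superset [of "{a}" _ "{b}"]) auto

lemma Yt_mult_add_left: "(x + x') \<otimes>\<^bsub>Yt n\<^esub> y = x \<otimes>\<^bsub>Yt n\<^esub> y + x' \<otimes>\<^bsub>Yt n\<^esub> y"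
proof -
  let ?S = "Poly_Mapping.keys x \<union> Poly_Mapping.keys x'" and ?S' = "Poly_Mapping.keys y"
  show ?thesis
    by (simp add: Yt_mult_superset [of ?S _ ?S'] keys_add lookup_add distrib_left distrib_right
        single_add sum.distrib)
qed

lemma Yt_mult_add_right: "y \<otimes>\<^bsub>Yt n\<^esub> (x + x') = y \<otimes>\<^bsub>Yt n\<^esub> x + y \<otimes>\<^bsub>Yt n\<^esub> x'"
proof -
  let ?S = "Poly_Mapping.keys x \<union> Poly_Mapping.keys x'" and ?S' = "Poly_Mapping.keys y"
  show ?thesis
    by (simp add: Yt_mult_superset [of ?S' _ ?S] keys_add lookup_add distrib_left distrib_right
        single_add sum.distrib)
qed

lemma lookup_Yt_mult_single_left:
  "Poly_Mapping.lookup (Poly_Mapping.single m c \<otimes>\<^bsub>Yt n\<^esub> y) (m + k)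
     = tpow (Nform n m k) * c * Poly_Mapping.lookup y k"
proof -
  let ?S = "insert k (Poly_Mapping.keys y)"
  have "Poly_Mapping.lookup (Poly_Mapping.single m c \<otimes>\<^bsub>Yt n\<^esub> y) (m + k)
     = (\<Sum>m2\<in>?S. if m2 = k then tpow (Nform n m m2) * c * Poly_Mapping.lookup y m2 else 0)"
    by (subst Yt_mult_superset [of "{m}" _ ?S]) (auto simp: lookup_sum lookup_single when_def
        intro!: sum.cong)
  then show ?thesis by simp
qed

text \<open>The exponent of t stays existential: it depends on the order of the factors and on
  inverses in Y_t, and is only ever used up to a unit.\<close>

definition is_tmono :: "mono \<Rightarrow> (mono \<Rightarrow>\<^sub>0 laurent) \<Rightarrow> bool" where
  "is_tmono m x \<longleftrightarrow> (\<exists>a. x = Poly_Mapping.single m (tpow a))"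

lemma is_tmono_one: "is_tmono 0 \<one>\<^bsub>Yt n\<^esub>"
  unfolding is_tmono_def one_Yt by blast

lemma is_tmono_bas: "is_tmono m (bas m)"
  unfolding is_tmono_def bas_def by (rule exI [of _ 0]) simp

lemma is_tmono_mult:
  assumes "is_tmono m x" "is_tmono m' y"
  shows "is_tmono (m + m') (x \<otimes>\<^bsub>Yt n\<^esub> y)"
  using assms by (auto simp: is_tmono_def Yt_mult_single tpow_mult)

text \<open>Left multiplication by t^a :m: only shifts monomials and rescales by powers of t, so it
  is injective; this gives the uniqueness that the definite description \<open>inv\<close>
  requires.\<close>

lemma is_tmono_inv:
  assumes "is_tmono m x" "m \<in> Mon n"
  shows "is_tmono (- m) (inv\<^bsub>Yt n\<^esub> x)"
proof -
  obtain a where a: "x = Poly_Mapping.single m (tpow a)" using assms(1) by (auto simp: is_tmono_def)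
  \<comment> \<open>N(m, -m) and N(-m, m) both equal -N(m, m), which this exponent
    compensates.\<close>
  define y where "y = Poly_Mapping.single (- m) (tpow (Nform n m m - a))"
  have "inv\<^bsub>Yt n\<^esub> x = y"
    unfolding m_inv_def
  proof (rule the_equality)
    show "y \<in> carrier (Yt n) \<and> x \<otimes>\<^bsub>Yt n\<^esub> y = \<one>\<^bsub>Yt n\<^esub> \<and> y \<otimes>\<^bsub>Yt n\<^esub> x = \<one>\<^bsub>Yt n\<^esub>"
      using assms(2)
      by (simp add: y_def a Yt_mult_single tpow_mult one_Yt Nform_uminus_left Nform_uminus_right)
         (simp add: Yt_def)
  next
    fix z assume "z \<in> carrier (Yt n) \<and> x \<otimes>\<^bsub>Yt n\<^esub> z = \<one>\<^bsub>Yt n\<^esub> \<and> z \<otimes>\<^bsub>Yt n\<^esub> x = \<one>\<^bsub>Yt n\<^esub>"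
    then have xz: "x \<otimes>\<^bsub>Yt n\<^esub> z = x \<otimes>\<^bsub>Yt n\<^esub> y"
      by (simp add: y_def a Yt_mult_single tpow_mult one_Yt Nform_uminus_right)
    have "Poly_Mapping.lookup z k = Poly_Mapping.lookup y k" for k
      using arg_cong [OF xz, of "\<lambda>w. tpow (- (Nform n m k + a)) * Poly_Mapping.lookup w (m + k)"]
      by (simp only: a lookup_Yt_mult_single_left tpow_mult tpow_cancel)
    then show "z = y" by (rule poly_mapping_eqI)
  qed
  then show ?thesis by (auto simp: is_tmono_def y_def)
qed

text \<open>\<open>P m x\<close> is to be read as "x has leading monomial m"; the compatibility with products is what
  makes it pass from the factors of \<open>E\<^bsub>i,t\<^esub>(m)\<close> to \<open>E\<^bsub>i,t\<^esub>(m)\<close>.\<close>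

definition mult_closed :: "nat \<Rightarrow> (mono \<Rightarrow> (mono \<Rightarrow>\<^sub>0 laurent) \<Rightarrow> bool) \<Rightarrow> bool" where
  "mult_closed n P \<longleftrightarrow> P 0 \<one>\<^bsub>Yt n\<^esub> \<and>
     (\<forall>m x m' y. P m x \<longrightarrow> P m' y \<longrightarrow> P (m + m') (x \<otimes>\<^bsub>Yt n\<^esub> y))"

lemma mult_closed_one: "mult_closed n P \<Longrightarrow> P 0 \<one>\<^bsub>Yt n\<^esub>"
  and mult_closed_mult: "mult_closed n P \<Longrightarrow> P m x \<Longrightarrow> P m' y \<Longrightarrow> P (m + m') (x \<otimes>\<^bsub>Yt n\<^esub> y)"
  by (simp_all add: mult_closed_def)

lemma mult_closed_tmono: "mult_closed n is_tmono"
  by (simp add: mult_closed_def is_tmono_one is_tmono_mult)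

lemma mult_closed_ordprod:
  assumes "mult_closed n P" "\<And>x. x \<in> set xs \<Longrightarrow> P (g x) (f x)"
  shows "P (sum_list (map g xs)) (ordprod n (map f xs))"
  using assms(2)
  by (induction xs) (auto simp: ordprod_def intro: mult_closed_one [OF assms(1)] mult_closed_mult
      [OF assms(1)])

lemma mult_closed_nat_pow:
  assumes "mult_closed n P" "P (Poly_Mapping.single q 1) x"
  shows "P (Poly_Mapping.single q (int k)) (x [^]\<^bsub>Yt n\<^esub> k)"
proof (induction k)
  case (Suc k)
  from mult_closed_mult [OF assms(1) this assms(2)]
  show ?case by (simp add: single_add [symmetric] add.commute)
qed (simp add: mult_closed_one [OF assms(1)])

lemma is_tmono_int_pow:
  assumes "j \<in> Idx n"
  shows "is_tmono (Poly_Mapping.single (j, l) k) (bas (Ymon j l) [^]\<^bsub>Yt n\<^esub> k)"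
proof -
  have pow: "is_tmono (Poly_Mapping.single (j, l) (int k)) (bas (Ymon j l) [^]\<^bsub>Yt n\<^esub> k)" for k ::
      nat
    using mult_closed_nat_pow [of n is_tmono, OF mult_closed_tmono] is_tmono_bas [of "Ymon j l"]
    unfolding Ymon_def by blast
  show ?thesis
  proof (cases "k < 0")
    case False
    then show ?thesis using pow [of "nat k"] by (simp add: pow_nat)
  next
    case True
    then have "bas (Ymon j l) [^]\<^bsub>Yt n\<^esub> k = inv\<^bsub>Yt n\<^esub> (bas (Ymon j l) [^]\<^bsub>Yt n\<^esub> (nat (- k)))"
      by (simp add: int_pow_def nat_pow_def)
    then show ?thesis
      using is_tmono_inv [OF pow [of "nat (- k)"] Mon_single [OF assms]] True
      by (simp add: single_uminus [symmetric])
  qed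
qed

lemma sum_single_lookup:
  assumes "finite S" "Poly_Mapping.keys m \<subseteq> S"
  shows "(\<Sum>x\<in>S. Poly_Mapping.single x (Poly_Mapping.lookup m x)) = m"
proof (rule poly_mapping_eqI)
  fix y
  have "Poly_Mapping.lookup (\<Sum>x\<in>S. Poly_Mapping.single x (Poly_Mapping.lookup m x)) y
      = (\<Sum>x\<in>S. if x = y then Poly_Mapping.lookup m x else 0)"
    by (auto simp: lookup_sum lookup_single when_def intro!: sum.cong)
  then show "Poly_Mapping.lookup (\<Sum>x\<in>S. Poly_Mapping.single x (Poly_Mapping.lookup m x)) y
      = Poly_Mapping.lookup m y"
    using assms by (auto simp: in_keys_iff)
qed

text \<open>Applied with \<open>has_leading\<close> for uniqueness and with \<open>is_thin\<close>
  for the columns. The exponents of the factors reassemble to \<open>m\<close>.\<close>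

lemma Eit_induct:
  assumes P: "mult_closed n P" and i: "i \<in> Idx n" and m: "m \<in> dominant n {i}"
    and gen: "\<And>l. P (Ymon i l) (bas (Ymon i l) \<otimes>\<^bsub>Yt n\<^esub> (bas 0 + Poly_Mapping.single (- Amon n i (l
        + 1)) (tpow 1)))"
    and tmono: "\<And>j l k x. j \<in> Idx n \<Longrightarrow> j \<noteq> i \<Longrightarrow> is_tmono (Poly_Mapping.single (j, l) k) x
      \<Longrightarrow> P (Poly_Mapping.single (j, l) k) x"
  shows "P m (Eit n i m)"
proof -
  let ?u = "Poly_Mapping.lookup m"
  let ?js = "filter (\<lambda>j. j \<noteq> i) [1..<n + 1]"
  let ?L = "snd ` Poly_Mapping.keys m"
  let ?g = "\<lambda>l. Poly_Mapping.single (i, l) (?u (i, l))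
      + sum_list (map (\<lambda>j. Poly_Mapping.single (j, l) (?u (j, l))) ?js)"
  have "P (sum_list (map ?g (sorted_list_of_set ?L))) (Eit n i m)"
    unfolding Eit_def
  proof (intro mult_closed_ordprod [OF P] mult_closed_mult [OF P])
    fix l
    \<comment> \<open>By i-dominance this power is a natural one, so closure of \<open>P\<close>
      under products handles it; the base is not a monomial, and no inverse of it is formed.\<close>
    have "?u (i, l) = int (nat (?u (i, l)))" using m by (simp add: dominant_def)
    then show "P (Poly_Mapping.single (i, l) (?u (i, l)))
       ((bas (Ymon i l) \<otimes>\<^bsub>Yt n\<^esub> (bas 0 + Poly_Mapping.single (- Amon n i (l
           + 1)) (tpow 1))) [^]\<^bsub>Yt n\<^esub> ?u (i, l))"
      using mult_closed_nat_pow [OF P gen [unfolded Ymon_def], of l "nat (?u (i, l))"]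
      unfolding Ymon_def by (simp add: pow_nat del: int_nat_eq)
    fix j assume "j \<in> set ?js"
    then show "P (Poly_Mapping.single (j, l) (?u (j, l))) (bas (Ymon j l) [^]\<^bsub>Yt n\<^esub> ?u (j, l))"
      by (intro tmono is_tmono_int_pow) (auto simp: Idx_def)
  qed
  also have "sum_list (map ?g (sorted_list_of_set ?L)) = (\<Sum>l\<in>?L. ?g l)"
    by (simp add: sum_list_distinct_conv_sum_set)
  also have "\<dots> = (\<Sum>l\<in>?L. \<Sum>j\<in>Idx n. Poly_Mapping.single (j, l) (?u (j, l)))"
  proof (rule sum.cong)
    fix l
    have "set ?js = Idx n - {i}" by (auto simp: Idx_def)
    then have "?g l = Poly_Mapping.single (i, l) (?u (i, l))
        + (\<Sum>j\<in>Idx n - {i}. Poly_Mapping.single (j, l) (?u (j, l)))"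
      by (subst sum_list_distinct_conv_sum_set) simp_all
    also have "\<dots> = (\<Sum>j\<in>Idx n. Poly_Mapping.single (j, l) (?u (j, l)))"
      using i by (intro sum.remove [symmetric]) simp_all
    finally show "?g l = (\<Sum>j\<in>Idx n. Poly_Mapping.single (j, l) (?u (j, l)))" .
  qed simp
  also have "\<dots> = (\<Sum>x\<in>Idx n \<times> ?L. Poly_Mapping.single x (?u x))"
    by (subst sum.swap) (simp add: sum.cartesian_product)
  also have "\<dots> = m"
    using m by (intro sum_single_lookup) (force simp: dominant_def Mon_def)+
  finally show ?thesis .
qed

text \<open>N(Y_{i,l}, A_{i,l+1}^{-1}) = -1, which cancels the t in 1 + t A_{i,l+1}^{-1}.\<close>

lemma Eit_factor:
  assumes "i \<in> Idx n"
  shows "bas (Ymon i l) \<otimes>\<^bsub>Yt n\<^esub> (bas 0 + Poly_Mapping.single (- Amon n i (l + 1)) (tpow 1))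
    = Poly_Mapping.single (Ymon i l) (tpow 0) + Poly_Mapping.single (Ymon i l - Amon n i (l
        + 1)) (tpow 0)"
proof -
  have "Nform n (Ymon i l) (Amon n i (l + 1)) = 1"
    using assms by (simp add: Nform_Amon_right Mon_Ymon) (simp add: Ymon_def lookup_single)
  then show ?thesis
    unfolding Yt_mult_add_right bas_def Yt_mult_single by (simp add: tpow_mult Nform_uminus_right)
qed

section \<open>Leading monomials of E_{i,t}(m)\<close>

definition has_leading :: "nat \<Rightarrow> mono \<Rightarrow> (mono \<Rightarrow>\<^sub>0 laurent) \<Rightarrow> bool" where
  "has_leading n m x \<longleftrightarrow> (\<exists>a. Poly_Mapping.lookup x m = tpow a) \<and>
     (\<forall>k\<in>Poly_Mapping.keys x. k \<noteq> m \<longrightarrow> height n k < height n m)"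

lemma has_leading_height:
  assumes "has_leading n m x" "k \<in> Poly_Mapping.keys x"
  shows "height n k \<le> height n m"
  using assms by (cases "k = m") (auto simp: has_leading_def)

lemma has_leading_tmono: "is_tmono m x \<Longrightarrow> has_leading n m x"
  by (auto simp: is_tmono_def has_leading_def split: if_splits)

text \<open>Heights add, so only the pair (m, m') reaches the height of m + m', and its coefficient
  is a product of powers of t. Such a unit keeps the leading term alive after multiplication by any
  nonzero coefficient.\<close>

lemma has_leading_mult:
  assumes x: "has_leading n m x" and y: "has_leading n m' y"
  shows "has_leading n (m + m') (x \<otimes>\<^bsub>Yt n\<^esub> y)"
proof -
  let ?X = "Poly_Mapping.keys x" and ?Y = "Poly_Mapping.keys y"
  let ?c = "\<lambda>a b. tpow (Nform n a b) * Poly_Mapping.lookup x a * Poly_Mapping.lookup y b"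
  have mult: "x \<otimes>\<^bsub>Yt n\<^esub> y = (\<Sum>(a, b)\<in>?X \<times> ?Y. Poly_Mapping.single (a + b) (?c a b))"
    by (subst Yt_mult_superset [of ?X _ ?Y]) (simp_all add: sum.cartesian_product)
  obtain a b where ab: "Poly_Mapping.lookup x m = tpow a" "Poly_Mapping.lookup y m' = tpow b"
    using x y by (auto simp: has_leading_def)
  then have mX: "m \<in> ?X" "m' \<in> ?Y" by (simp_all add: in_keys_iff)
  have eq: "a = m \<and> b = m'" if "a \<in> ?X" "b \<in> ?Y" "height n (a + b) \<ge> height n (m + m')" for a b
    using that has_leading_height [OF x that(1)] has_leading_height [OF y that(2)] x y
    by (force simp: has_leading_def height_add)
  have "Poly_Mapping.lookup (x \<otimes>\<^bsub>Yt n\<^esub> y) (m + m')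
     = (\<Sum>p\<in>?X \<times> ?Y. if p = (m, m') then ?c m m' else 0)"
    unfolding mult lookup_sum
  proof (rule sum.cong [OF refl])
    fix p assume "p \<in> ?X \<times> ?Y"
    then obtain a b where "p = (a, b)" "a \<in> ?X" "b \<in> ?Y" by blast
    with eq [of a b] show "Poly_Mapping.lookup (case p of (a, b) \<Rightarrow> Poly_Mapping.single (a
        + b) (?c a b)) (m + m')
        = (if p = (m, m') then ?c m m' else 0)"
      by (cases "a + b = m + m'") (auto simp: lookup_single)
  qed
  also have "\<dots> = tpow (Nform n m m' + a + b)"
    using mX by (simp add: ab tpow_mult)
  finally have 1: "Poly_Mapping.lookup (x \<otimes>\<^bsub>Yt n\<^esub> y) (m + m') = tpow (Nform n m m' + a + b)" .
  have 2: "height n k < height n (m + m')"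
    if "k \<in> Poly_Mapping.keys (x \<otimes>\<^bsub>Yt n\<^esub> y)" "k \<noteq> m + m'" for k
  proof -
    have "Poly_Mapping.lookup (x \<otimes>\<^bsub>Yt n\<^esub> y) k \<noteq> 0" using that by (simp add: in_keys_iff)
    then obtain p where "p \<in> ?X \<times> ?Y" "Poly_Mapping.lookup (case p of (a, b) \<Rightarrow> Poly_Mapping.single
        (a + b) (?c a b)) k \<noteq> 0"
      unfolding mult lookup_sum by (rule sum.not_neutral_contains_not_neutral)
    then obtain a b where "a \<in> ?X" "b \<in> ?Y" "k = a + b"
      by (auto simp: lookup_single when_def split: if_splits)
    then show ?thesis using eq [of a b] that(2) by force
  qed
  from 1 2 show ?thesis by (auto simp: has_leading_def)
qed

lemma Eit_leading:
  assumes "i \<in> Idx n" "m \<in> dominant n {i}"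
  shows "has_leading n m (Eit n i m)"
proof (rule Eit_induct [OF _ assms])
  show "mult_closed n (has_leading n)"
    by (simp add: mult_closed_def has_leading_mult has_leading_tmono is_tmono_one)
next
  fix l
  let ?A = "Amon n i (l + 1)"
  have h: "height n (Ymon i l - ?A) < height n (Ymon i l)"
    by (simp add: height_diff height_Amon assms)
  then have "Ymon i l - ?A \<noteq> Ymon i l" by auto
  with h show "has_leading n (Ymon i l) (bas (Ymon i l) \<otimes>\<^bsub>Yt n\<^esub> (bas 0
      + Poly_Mapping.single (- ?A) (tpow 1)))"
    unfolding Eit_factor [OF assms(1)] has_leading_def
    by (auto simp: lookup_add lookup_single when_def in_keys_iff intro!: exI [of _ 0] split:
        if_splits)
qed (rule has_leading_tmono)

section \<open>E_{i,t}(m) when m involves at most one Y_{i,l}\<close>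

definition is_pair :: "nat \<Rightarrow> nat \<Rightarrow> int \<Rightarrow> mono \<Rightarrow> (mono \<Rightarrow>\<^sub>0 laurent) \<Rightarrow> bool" where
  "is_pair n i l m x \<longleftrightarrow> (\<exists>a. x = Poly_Mapping.single m (tpow a)
     + Poly_Mapping.single (m - Amon n i (l + 1)) (tpow a))"

text \<open>Nothing is claimed beyond exponents 0 or a single 1 in direction i, yet the property is
  multiplicative: nonnegative exponents whose sum has this shape have this shape themselves.\<close>

definition is_thin :: "nat \<Rightarrow> nat \<Rightarrow> mono \<Rightarrow> (mono \<Rightarrow>\<^sub>0 laurent) \<Rightarrow> bool" where
  "is_thin n i m x \<longleftrightarrow> m \<in> dominant n {i} \<and>
     ((\<forall>l. Poly_Mapping.lookup m (i, l) = 0) \<longrightarrow> is_tmono m x) \<and>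
     (\<forall>l. (\<forall>l'. Poly_Mapping.lookup m (i, l') = (if l' = l then 1 else 0)) \<longrightarrow> is_pair n i l m x)"

lemma is_thinI:
  assumes "m \<in> dominant n {i}"
    and "(\<And>l. Poly_Mapping.lookup m (i, l) = 0) \<Longrightarrow> is_tmono m x"
    and "\<And>l. (\<And>l'. Poly_Mapping.lookup m (i, l') = (if l' = l then 1 else 0)) \<Longrightarrow> is_pair n i l m x"
  shows "is_thin n i m x"
  unfolding is_thin_def using assms by blast

lemma is_thin_dominant: "is_thin n i m x \<Longrightarrow> m \<in> dominant n {i}"
  unfolding is_thin_def by blast

lemma is_thin_tmono:
  "is_thin n i m x \<Longrightarrow> (\<And>l. Poly_Mapping.lookup m (i, l) = 0) \<Longrightarrow> is_tmono m x"
  unfolding is_thin_def by blast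

lemma is_thin_pair:
  assumes "is_thin n i m x" "\<And>l'. Poly_Mapping.lookup m (i, l') = (if l' = l then 1 else 0)"
  shows "is_pair n i l m x"
  using assms unfolding is_thin_def by blast

text \<open>N(p, A_{i,l+1}) = 0 because p is free of the Y_{i,l}, so multiplication by p changes the
  power of t equally on both members.\<close>

lemma is_pair_mult:
  assumes i: "i \<in> Idx n" and p: "p \<in> Mon n" "\<And>l. Poly_Mapping.lookup p (i, l) = 0"
    and x: "is_tmono p x" and y: "is_pair n i l m y"
  shows "is_pair n i l (p + m) (x \<otimes>\<^bsub>Yt n\<^esub> y)" "is_pair n i l (m + p) (y \<otimes>\<^bsub>Yt n\<^esub> x)"
proof -
  let ?A = "Amon n i (l + 1)"
  obtain a b where xy: "x = Poly_Mapping.single p (tpow a)"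
      "y = Poly_Mapping.single m (tpow b) + Poly_Mapping.single (m - ?A) (tpow b)"
    using x y by (auto simp: is_tmono_def is_pair_def)
  have N: "Nform n p ?A = 0" "Nform n ?A p = 0"
    using i p by (simp_all add: Nform_Amon_left Nform_Amon_right)
  show "is_pair n i l (p + m) (x \<otimes>\<^bsub>Yt n\<^esub> y)"
    by (auto simp: is_pair_def xy Yt_mult_add_right Yt_mult_single tpow_mult Nform_diff_right N
        add_diff_eq)
  show "is_pair n i l (m + p) (y \<otimes>\<^bsub>Yt n\<^esub> x)"
    by (auto simp: is_pair_def xy Yt_mult_add_left Yt_mult_single tpow_mult Nform_diff_left N
        diff_add_eq)
qed

lemma dominant_add: "a \<in> dominant n J \<Longrightarrow> b \<in> dominant n J \<Longrightarrow> a + b \<in> dominant n J"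
  by (auto simp: dominant_def Mon_add lookup_add)

lemma is_thin_mult:
  assumes i: "i \<in> Idx n" and x: "is_thin n i m x" and y: "is_thin n i m' y"
  shows "is_thin n i (m + m') (x \<otimes>\<^bsub>Yt n\<^esub> y)"
proof (rule is_thinI)
  let ?u = "Poly_Mapping.lookup m" and ?v = "Poly_Mapping.lookup m'"
  have dom: "m \<in> dominant n {i}" "m' \<in> dominant n {i}"
    using is_thin_dominant [OF x] is_thin_dominant [OF y] .
  then show "m + m' \<in> dominant n {i}" by (rule dominant_add)
  have Mon: "m \<in> Mon n" "m' \<in> Mon n" and nonneg: "?u (i, l) \<ge> 0" "?v (i, l) \<ge> 0" for l
    using dom by (simp_all add: dominant_def)
  {
    assume zero: "\<And>l. Poly_Mapping.lookup (m + m') (i, l) = 0"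
    have "?u (i, l) = 0" "?v (i, l) = 0" for l
      using nonneg [of l] zero [of l] by (simp_all add: lookup_add)
    then show "is_tmono (m + m') (x \<otimes>\<^bsub>Yt n\<^esub> y)"
      using is_tmono_mult [OF is_thin_tmono [OF x] is_thin_tmono [OF y]] by blast
  next
    fix l assume one: "\<And>l'. Poly_Mapping.lookup (m + m') (i, l') = (if l' = l then 1 else 0)"
    have zero: "?u (i, l') = 0" "?v (i, l') = 0" if "l' \<noteq> l" for l'
      using nonneg [of l'] one [of l'] that by (simp_all add: lookup_add)
    have "?u (i, l) + ?v (i, l) = 1" using one [of l] by (simp add: lookup_add)
    then consider "?u (i, l) = 1" "?v (i, l) = 0" | "?u (i, l) = 0" "?v (i, l) = 1"
      using nonneg [of l] by linarith
    then show "is_pair n i l (m + m') (x \<otimes>\<^bsub>Yt n\<^esub> y)"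
    proof cases
      case 1
      have v: "?v (i, l') = 0" for l' using zero(2) [of l'] 1 by (cases "l' = l") simp_all
      have u: "?u (i, l') = (if l' = l then 1 else 0)" for l'
        using zero(1) [of l'] 1 by (cases "l' = l") simp_all
      show ?thesis
        by (rule is_pair_mult(2) [OF i Mon(2) v is_thin_tmono [OF y v] is_thin_pair [OF x u]])
    next
      case 2
      have u: "?u (i, l') = 0" for l' using zero(1) [of l'] 2 by (cases "l' = l") simp_all
      have v: "?v (i, l') = (if l' = l then 1 else 0)" for l'
        using zero(2) [of l'] 2 by (cases "l' = l") simp_all
      show ?thesis
        by (rule is_pair_mult(1) [OF i Mon(1) u is_thin_tmono [OF x u] is_thin_pair [OF y v]])
    qed
  }
qed

lemma Eit_thin:
  assumes "i \<in> Idx n" "m \<in> dominant n {i}"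
  shows "is_thin n i m (Eit n i m)"
proof (rule Eit_induct [OF _ assms])
  have "is_thin n i 0 \<one>\<^bsub>Yt n\<^esub>"
  proof (rule is_thinI)
    fix l assume "\<And>l'. Poly_Mapping.lookup (0 :: mono) (i, l') = (if l' = l then 1 else 0)"
    from this [of l] show "is_pair n i l 0 \<one>\<^bsub>Yt n\<^esub>" by simp
  qed (simp_all add: dominant_def is_tmono_one)
  then show "mult_closed n (is_thin n i)"
    unfolding mult_closed_def using is_thin_mult [OF assms(1)] by blast
next
  fix l
  show "is_thin n i (Ymon i l) (bas (Ymon i l) \<otimes>\<^bsub>Yt n\<^esub> (bas 0 + Poly_Mapping.single (- Amon n i (l
      + 1)) (tpow 1)))"
  proof (rule is_thinI)
    show "Ymon i l \<in> dominant n {i}"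
      using assms by (simp add: dominant_def Mon_Ymon) (simp add: Ymon_def lookup_single when_def)
  next
    assume "\<And>k. Poly_Mapping.lookup (Ymon i l) (i, k) = 0"
    from this [of l] show "is_tmono (Ymon i l)
       (bas (Ymon i l) \<otimes>\<^bsub>Yt n\<^esub> (bas 0 + Poly_Mapping.single (- Amon n i (l + 1)) (tpow 1)))"
      by (simp add: Ymon_def)
  next
    fix k assume "\<And>l'. Poly_Mapping.lookup (Ymon i l) (i, l') = (if l' = k then 1 else 0)"
    from this [of l] have "k = l" by (auto simp: Ymon_def split: if_splits)
    then show "is_pair n i k (Ymon i l)
       (bas (Ymon i l) \<otimes>\<^bsub>Yt n\<^esub> (bas 0 + Poly_Mapping.single (- Amon n i (l + 1)) (tpow 1)))"
      unfolding Eit_factor [OF assms(1)] is_pair_def by blast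
  qed
next
  fix j l k x
  assume *: "j \<in> Idx n" "j \<noteq> i" "is_tmono (Poly_Mapping.single (j, l) k) x"
  have zero: "Poly_Mapping.lookup (Poly_Mapping.single (j, l) k) (i, l') = 0" for l'
    using * by (simp add: lookup_single)
  show "is_thin n i (Poly_Mapping.single (j, l) k) x"
  proof (rule is_thinI)
    fix l' assume "\<And>r. Poly_Mapping.lookup (Poly_Mapping.single (j, l) k) (i, r) = (if r
        = l' then 1 else 0)"
    from this [of l'] zero [of l'] show "is_pair n i l' (Poly_Mapping.single (j, l) k) x" by simp
  qed (use * zero in \<open>simp_all add: dominant_def Mon_single\<close>)
qed

section \<open>Uniqueness\<close>

text \<open>One coefficient function replaces the grading by K and the finite sum over M. Finiteness
  above every height is what remains of the completion: it makes each coefficient of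
  \<open>x\<close> a finite sum and gives a nonzero \<open>x\<close> a maximal height.\<close>

definition expansion :: "nat \<Rightarrow> nat \<Rightarrow> (mono \<Rightarrow> laurent) \<Rightarrow> (mono \<Rightarrow> laurent) \<Rightarrow> bool" where
  "expansion n i c x \<longleftrightarrow> (\<forall>m. c m \<noteq> 0 \<longrightarrow> m \<in> dominant n {i}) \<and>
     (\<forall>H. finite {m. c m \<noteq> 0 \<and> H \<le> height n m}) \<and>
     (\<forall>m. x m = Sum_any (\<lambda>m'. c m' * Poly_Mapping.lookup (Eit n i m') m))"

lemma expansion_dominant: "expansion n i c x \<Longrightarrow> c m \<noteq> 0 \<Longrightarrow> m \<in> dominant n {i}"
  and expansion_finite: "expansion n i c x \<Longrightarrow> finite {m. c m \<noteq> 0 \<and> H \<le> height n m}"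
  and expansion_eq: "expansion n i c x \<Longrightarrow> x m = Sum_any (\<lambda>m'. c m'
      * Poly_Mapping.lookup (Eit n i m') m)"
  unfolding expansion_def by blast+

lemma expansion_term_height:
  assumes "i \<in> Idx n" "expansion n i c x" "c m' * Poly_Mapping.lookup (Eit n i m') m \<noteq> 0"
  shows "m' \<in> dominant n {i}" "height n m \<le> height n m'" "m = m' \<or> height n m < height n m'"
proof -
  have nz: "c m' \<noteq> 0" "m \<in> Poly_Mapping.keys (Eit n i m')"
    using assms(3) by (auto simp: in_keys_iff)
  show dom: "m' \<in> dominant n {i}" by (rule expansion_dominant [OF assms(2) nz(1)])
  show "height n m \<le> height n m'" "m = m' \<or> height n m < height n m'"
    using has_leading_height [OF Eit_leading [OF assms(1) dom] nz(2)] Eit_leading [OF assms(1)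
        dom] nz(2)
    by (auto simp: has_leading_def)
qed

text \<open>E_{i,t}(m') reaches m only if m' is at least as high.\<close>

lemma expansion_finite_terms:
  assumes "i \<in> Idx n" "expansion n i c x"
  shows "finite {m'. c m' * Poly_Mapping.lookup (Eit n i m') m \<noteq> 0}"
  by (rule finite_subset [OF _ expansion_finite [OF assms(2), of "height n m"]])
     (use expansion_term_height(2) [OF assms] in auto)

lemma expansion_zero: "expansion n i (\<lambda>_. 0) (\<lambda>_. 0)"
  by (simp add: expansion_def)

lemma expansion_lincomb:
  assumes i: "i \<in> Idx n" and x: "expansion n i c x" and y: "expansion n i d y"
  shows "expansion n i (\<lambda>m. c m + a * d m) (\<lambda>m. x m + a * y m)"
proof -
  have dom: "m \<in> dominant n {i}" if "c m + a * d m \<noteq> 0" for m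
    using that expansion_dominant [OF x, of m] expansion_dominant [OF y, of m] by fastforce
  have fin: "finite {m. c m + a * d m \<noteq> 0 \<and> H \<le> height n m}" for H
    by (rule finite_subset [OF _ finite_UnI [OF expansion_finite [OF x, of H] expansion_finite [OF
        y, of H]]]) auto
  have sum: "x m + a * y m = Sum_any (\<lambda>m'. (c m' + a * d m')
      * Poly_Mapping.lookup (Eit n i m') m)" for m
  proof -
    let ?E = "\<lambda>m'. Poly_Mapping.lookup (Eit n i m') m"
    \<comment> \<open>\<open>Sum_any\<close> is additive only on finite supports.\<close>
    note f1 = expansion_finite_terms [OF i x, of m] and f2 = expansion_finite_terms [OF i y, of m]
    have f3: "finite {m'. a * (d m' * ?E m') \<noteq> 0}"
      by (rule finite_subset [OF _ f2]) auto
    have "x m + a * y m = Sum_any (\<lambda>m'. c m' * ?E m') + a * Sum_any (\<lambda>m'. d m' * ?E m')"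
      by (simp only: expansion_eq [OF x, of m] expansion_eq [OF y, of m])
    also have "\<dots> = Sum_any (\<lambda>m'. c m' * ?E m' + a * (d m' * ?E m'))"
      by (simp only: Sum_any_right_distrib [OF f2] Sum_any.distrib [OF f1 f3])
    finally show ?thesis by (simp only: distrib_right mult.assoc)
  qed
  show ?thesis using dom fin sum unfolding expansion_def by blast
qed

lemma expansion_diff:
  assumes "i \<in> Idx n" "expansion n i c x" "expansion n i d y"
  shows "expansion n i (\<lambda>m. c m - d m) (\<lambda>m. x m - y m)"
  using expansion_lincomb [OF assms, of "- 1"] by simp

lemma expansion_sum:
  assumes i: "i \<in> Idx n" and "\<And>M. M \<in> S \<Longrightarrow> \<exists>c. expansion n i c (x M)"
  shows "\<exists>c. expansion n i c (\<lambda>m. \<Sum>M\<in>S. x M m)"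
  using assms(2)
proof (induction S rule: infinite_finite_induct)
  case (insert M S)
  then obtain c d where "expansion n i c (x M)" "expansion n i d (\<lambda>m. \<Sum>M\<in>S. x M m)"
    by (meson insertCI)
  from expansion_lincomb [OF i this, of 1] insert show ?case by auto
qed (auto intro: expansion_zero)

section \<open>From the completed kernels to expansions\<close>

lemma height_Aprod: "a \<in> Aprod n K \<Longrightarrow> height n a = - 2 * int K"
proof -
  assume "a \<in> Aprod n K"
  then obtain ps where ps: "a = sum_list (map (\<lambda>(j, l). - Amon n j l) ps)" "length ps
      = K" "set ps \<subseteq> Idx n \<times> UNIV"
    by (auto simp: Aprod_def)
  have "height n (sum_list (map (\<lambda>(j, l). - Amon n j l) ps)) = - 2 * int (length ps)"
    using ps(3) by (induction ps) (auto simp: height_add height_uminus height_Amon)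
  with ps show ?thesis by simp
qed

lemma Kit_block_expansion:
  assumes i: "i \<in> Idx n" and "x \<in> Kit_block n i M"
  shows "\<exists>c. expansion n i c x"
proof -
  obtain b where x: "x = (\<lambda>m. Sum_any (\<lambda>K::nat. \<Sum>a\<in>Poly_Mapping.keys (b K).
            Poly_Mapping.lookup (b K) a * Poly_Mapping.lookup (Eit n i (M + a)) m))"
    and b: "\<And>K. Poly_Mapping.keys (b K) \<subseteq> {a \<in> Aprod n K. M + a \<in> dominant n {i}}"
    using assms(2) unfolding Kit_block_def by blast
  have ht: "height n (M + a) = height n M - 2 * int K" if "a \<in> Poly_Mapping.keys (b K)" for a K
    using b [of K] that height_Aprod [of a n K] by (auto simp: height_add)
  \<comment> \<open>K factors lower the height by 2K, so K is recovered from the height of m.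
    Rounding and truncation at 0 do no harm: a nonzero value places m - M among the keys of some
    \<open>b K\<close>.\<close>
  define c where "c m = Poly_Mapping.lookup (b (nat ((height n M - height n m) div 2))) (m - M)"
      for m
  have c: "c (M + a) = Poly_Mapping.lookup (b K) a" if "a \<in> Poly_Mapping.keys (b K)" for a K
    using ht [OF that] by (simp add: c_def)
  have supp: "\<exists>K a. m = M + a \<and> a \<in> Poly_Mapping.keys (b K)" if "c m \<noteq> 0" for m
    using that unfolding c_def in_keys_iff [symmetric]
        by (metis add_diff_cancel_left' diff_add_cancel add.commute)
  define T where "T B = (\<Union>K\<le>B. (+) M ` Poly_Mapping.keys (b K))" for B
  have fin: "finite (T B)" for B by (auto simp: T_def)
  have T: "m \<in> T (nat (height n M - H))" if nz: "c m \<noteq> 0" and H: "H \<le> height n m" for m H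
  proof -
    obtain K a where Ka: "m = M + a" "a \<in> Poly_Mapping.keys (b K)" using supp [OF nz] by blast
    then have "K \<le> nat (height n M - H)" using ht [OF Ka(2)] H by simp
    with Ka show ?thesis by (auto simp: T_def)
  qed
  have dom: "m \<in> dominant n {i}" if "c m \<noteq> 0" for m
    using supp [OF that] b by blast
  have "x m = Sum_any (\<lambda>m'. c m' * Poly_Mapping.lookup (Eit n i m') m)" for m
  proof -
    \<comment> \<open>For K > B all monomials of E_{i,t}(M + a) lie below the height of m, so both
      infinite sums reduce to the indices up to B.\<close>
    define B where "B = nat (height n M - height n m)"
    let ?E = "\<lambda>m'. Poly_Mapping.lookup (Eit n i m') m"
    have E: "height n m \<le> height n m'" if "m' \<in> dominant n {i}" "?E m' \<noteq> 0" for m'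
      using has_leading_height [OF Eit_leading [OF i that(1)]] that(2) by (simp add: in_keys_iff)
    have "{m'. c m' * ?E m' \<noteq> 0} \<subseteq> T B"
      using T E dom by (auto simp: B_def)
    then have "Sum_any (\<lambda>m'. c m' * ?E m') = (\<Sum>m'\<in>T B. c m' * ?E m')"
      by (rule Sum_any.expand_superset [OF fin])
    also have "\<dots> = (\<Sum>K\<le>B. \<Sum>m'\<in>(+) M ` Poly_Mapping.keys (b K). c m' * ?E m')"
      unfolding T_def
    proof (rule sum.UNION_disjoint)
      show "\<forall>K\<in>{..B}. \<forall>L\<in>{..B}. K \<noteq> L \<longrightarrow>
          (+) M ` Poly_Mapping.keys (b K) \<inter> (+) M ` Poly_Mapping.keys (b L) = {}"
      proof (intro ballI impI equals0I)
        fix K L m' assume "K \<noteq> L" "m' \<in> (+) M ` Poly_Mapping.keys (b K) \<inter> (+) M `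
            Poly_Mapping.keys (b L)"
        then obtain a where "a \<in> Poly_Mapping.keys (b K)" "a \<in> Poly_Mapping.keys (b L)" by auto
        from ht [OF this(1)] ht [OF this(2)] \<open>K \<noteq> L\<close> show False by simp
      qed
    qed auto
    also have "\<dots> = (\<Sum>K\<le>B. \<Sum>a\<in>Poly_Mapping.keys (b K). Poly_Mapping.lookup (b K) a * ?E (M + a))"
      by (rule sum.cong [OF refl]) (simp add: sum.reindex c)
    also have "\<dots> = x m"
      unfolding x
    proof (rule Sum_any.expand_superset [symmetric])
      show "{K. (\<Sum>a\<in>Poly_Mapping.keys (b K). Poly_Mapping.lookup (b K) a * ?E (M + a)) \<noteq> 0} \<subseteq> {..B}"
      proof
        fix K assume "K \<in> {K. (\<Sum>a\<in>Poly_Mapping.keys (b K). Poly_Mapping.lookup (b K) a * ?E (M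
            + a)) \<noteq> 0}"
        then obtain a where a: "a \<in> Poly_Mapping.keys (b K)" "?E (M + a) \<noteq> 0"
          by (metis (mono_tags, lifting) mem_Collect_eq mult_zero_right sum.neutral)
        then have "height n m \<le> height n (M + a)" using b [of K] by (intro E) auto
        then show "K \<in> {..B}" using ht [OF a(1)] by (simp add: B_def)
      qed
    qed simp
    finally show ?thesis by simp
  qed
  moreover have "finite {m. c m \<noteq> 0 \<and> H \<le> height n m}" for H
    by (rule finite_subset [OF _ fin [of "nat (height n M - H)"]]) (use T in auto)
  ultimately have "expansion n i c x" using dom unfolding expansion_def by blast
  then show ?thesis by (rule exI [of _ c])
qed

lemma Kit_inf_expansion:
  assumes "i \<in> Idx n" "x \<in> Kit_inf n i"
  shows "\<exists>c. expansion n i c x"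
proof -
  obtain S y where "x = (\<lambda>m. \<Sum>M\<in>S. y M m)" "\<And>M. M \<in> S \<Longrightarrow> y M \<in> Kit_block n i M"
    using assms(2) unfolding Kit_inf_def by blast
  then show ?thesis using expansion_sum [OF assms(1)] Kit_block_expansion [OF assms(1)] by metis
qed

text \<open>No cancellation is possible in maximal height, so there the support of an expansion consists
  of \<open>i\<close>-dominant monomials.\<close>

lemma expansion_top:
  assumes i: "i \<in> Idx n" and x: "expansion n i c x" and nz: "x m0 \<noteq> 0"
  obtains m1 where "x m1 \<noteq> 0" "\<And>m. x m \<noteq> 0 \<Longrightarrow> height n m \<le> height n m1"
    "\<And>m. x m \<noteq> 0 \<Longrightarrow> height n m = height n m1 \<Longrightarrow> m \<in> dominant n {i}"
proof -
  let ?E = "\<lambda>m' m. Poly_Mapping.lookup (Eit n i m') m"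
  have contrib: "\<exists>m'. c m' * ?E m' m \<noteq> 0" if "x m \<noteq> 0" for m
    using that expansion_eq [OF x, of m] by (metis (no_types, lifting) Sum_any.neutral Sum_any.cong)
  obtain m' where m': "c m' \<noteq> 0" using contrib [OF nz] by auto
  \<comment> \<open>The support of \<open>c\<close> may be infinite downwards; cutting it at the
    height of one m' makes it finite without losing the maximum.\<close>
  define T where "T = {m. c m \<noteq> 0 \<and> height n m' \<le> height n m}"
  have "finite T" unfolding T_def by (rule expansion_finite [OF x])
  moreover have "m' \<in> T" using m' by (simp add: T_def)
  ultimately obtain m1 where m1: "m1 \<in> T" "\<And>m. m \<in> T \<Longrightarrow> height n m \<le> height n m1"
    using obtains_MAX [of T "height n"] Max_ge [of "height n ` T"]
        by (metis empty_iff finite_imageI image_eqI)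
  have max: "height n m \<le> height n m1" if "c m \<noteq> 0" for m
    using that m1 by (cases "height n m' \<le> height n m") (force simp: T_def)+
  have cm1: "c m1 \<noteq> 0" using m1 by (simp add: T_def)
  obtain a where a: "?E m1 m1 = tpow a"
    using Eit_leading [OF i expansion_dominant [OF x cm1]] by (auto simp: has_leading_def)
  \<comment> \<open>Another term reaching m1 would need a leading monomial higher than m1, against
    the choice of m1.\<close>
  have zero: "c m * ?E m m1 = 0" if "m \<noteq> m1" for m
  proof (rule ccontr)
    assume neq: "c m * ?E m m1 \<noteq> 0"
    then have "c m \<noteq> 0" by auto
    from max [OF this] expansion_term_height(3) [OF i x neq] that show False by auto
  qed
  have "x m1 = Sum_any (\<lambda>m. if m = m1 then c m1 * ?E m1 m1 else 0)"
    unfolding expansion_eq [OF x, of m1] by (rule Sum_any.cong) (simp add: zero)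
  then have "x m1 = tpow a * c m1" by (simp add: a mult.commute)
  then have "x m1 \<noteq> 0" using cm1 tpow_cancel [of a "c m1"] by auto
  moreover have "height n m \<le> height n m1" if xm: "x m \<noteq> 0" for m
  proof -
    obtain m'' where m'': "c m'' * ?E m'' m \<noteq> 0" using contrib [OF xm] by blast
    then have "c m'' \<noteq> 0" by auto
    from max [OF this] expansion_term_height(2) [OF i x m''] show ?thesis by simp
  qed
  moreover have "m \<in> dominant n {i}" if xm: "x m \<noteq> 0" and h: "height n m = height n m1" for m
  proof -
    obtain m'' where m'': "c m'' * ?E m'' m \<noteq> 0" using contrib [OF xm] by blast
    then have "c m'' \<noteq> 0" by auto
    from max [OF this] expansion_term_height(1,3) [OF i x m''] h show ?thesis by auto
  qed
  ultimately show ?thesis using that by blast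
qed

text \<open>The expansions differ from one i to the next, but the maximal height of the support
  belongs to x alone, so one monomial is i-dominant for all i.\<close>

lemma expansions_dominant_zero:
  assumes "Idx n \<noteq> {}" and ex: "\<And>i. i \<in> Idx n \<Longrightarrow> \<exists>c. expansion n i c x"
    and zero: "\<And>m. m \<in> dominant n (Idx n) \<Longrightarrow> x m = 0"
  shows "x m = 0"
proof (rule ccontr)
  assume nz: "x m \<noteq> 0"
  obtain i where i: "i \<in> Idx n" using assms(1) by blast
  obtain c where "expansion n i c x" using ex [OF i] by blast
  from expansion_top [OF i this nz] obtain m1 where
    m1: "x m1 \<noteq> 0" "\<And>m. x m \<noteq> 0 \<Longrightarrow> height n m \<le> height n m1" by metis
  have "m1 \<in> dominant n {j}" if j: "j \<in> Idx n" for j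
  proof -
    obtain c where "expansion n j c x" using ex [OF j] by blast
    from expansion_top [OF j this nz] obtain m2 where
      m2: "x m2 \<noteq> 0" "\<And>m. x m \<noteq> 0 \<Longrightarrow> height n m \<le> height n m2"
      "\<And>m. x m \<noteq> 0 \<Longrightarrow> height n m = height n m2 \<Longrightarrow> m \<in> dominant n {j}" by metis
    from m1(2) [OF m2(1)] m2(2) [OF m1(1)] show ?thesis by (intro m2(3) m1(1)) simp
  qed
  then have "m1 \<in> dominant n (Idx n)" using i by (auto simp: dominant_def)
  then show False using zero m1(1) by blast
qed

section \<open>Columns\<close>

definition cnt :: "nat set \<Rightarrow> nat \<Rightarrow> nat" where
  "cnt T j = card (T \<inter> {1..j})"

lemma cnt_Suc: "cnt T (Suc j) = cnt T j + (if Suc j \<in> T then 1 else 0)"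
proof -
  have "T \<inter> {1..Suc j} = (if Suc j \<in> T then insert (Suc j) (T \<inter> {1..j}) else T \<inter> {1..j})"
    by (auto simp: le_Suc_eq)
  then show ?thesis by (simp add: cnt_def)
qed

definition level :: "nat \<Rightarrow> nat set \<Rightarrow> nat \<Rightarrow> int" where
  "level k T j = int k + int j - 2 * int (cnt T j)"

definition step :: "nat set \<Rightarrow> nat \<Rightarrow> int" where
  "step T j = (if j \<in> T then 1 else 0) - (if Suc j \<in> T then 1 else 0)"

text \<open>The box \<open>j\<close> of a column \<open>T\<close> of length \<open>k\<close> contributes
  \<open>Y\<^bsub>j,a+j-1\<^esub> Y\<^bsub>j-1,a+j\<^esub>\<^sup>-\<^sup>1\<close> with \<open>a = k + 1 - 2 * cnt T j\<close>. Collecting the powers of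
  \<open>Y\<^bsub>j,_\<^esub>\<close> from the boxes \<open>j\<close> and \<open>j + 1\<close>, both sit on \<open>level k T j\<close>.\<close>

definition column_mono :: "nat \<Rightarrow> nat \<Rightarrow> nat set \<Rightarrow> mono" where
  "column_mono n k T = (\<Sum>j\<in>Idx n. Poly_Mapping.single (j, level k T j) (step T j))"

lemma lookup_column_mono:
  "Poly_Mapping.lookup (column_mono n k T) (p, l)
     = (if p \<in> Idx n \<and> l = level k T p then step T p else 0)"
proof -
  have "Poly_Mapping.lookup (column_mono n k T) (p, l)
     = (\<Sum>j\<in>Idx n. if j = p then (if l = level k T p then step T p else 0) else 0)"
    unfolding column_mono_def lookup_sum by (intro sum.cong) (auto simp: lookup_single when_def)
  then show ?thesis by simp
qed

lemma column_mono_Mon: "column_mono n k T \<in> Mon n"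
  unfolding column_mono_def by (intro Mon_sum Mon_single)

text \<open>For p in T and p + 1 not in T this is the Kashiwara operator f_p on columns.\<close>

definition raise :: "nat \<Rightarrow> nat set \<Rightarrow> nat set" where
  "raise p T = insert (Suc p) (T - {p})"

lemma mem_raise: "j \<in> raise p T \<longleftrightarrow> j = Suc p \<or> j \<noteq> p \<and> j \<in> T"
  by (auto simp: raise_def)

lemma cnt_raise:
  assumes "p \<in> T" "Suc p \<notin> T" "1 \<le> p"
  shows "int (cnt (raise p T) j) = int (cnt T j) - (if j = p then 1 else 0)"
proof (induction j)
  case 0
  then show ?case using assms by (simp add: cnt_def)
next
  case (Suc j)
  then show ?case using assms by (auto simp: cnt_Suc mem_raise split: if_splits)
qed

text \<open>Only the count at p changes, by -1: with l the level at p, Y_{p,l} becomes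
  Y_{p,l+2}^{-1}. The neighbours of p sit on level l + 1 and each gain exponent 1.\<close>

lemma column_mono_raise:
  assumes p: "p \<in> Idx n" and T: "p \<in> T" "Suc p \<notin> T"
  shows "column_mono n k (raise p T) = column_mono n k T - Amon n p (level k T p + 1)"
proof (rule poly_mapping_eqI)
  fix x :: "nat \<times> int"
  obtain j l where x: "x = (j, l)" by (cases x)
  define s where "s = level k T p + 1"
  obtain q where q: "p = Suc q" using p by (cases p) (auto simp: Idx_def)
  have lev: "level k (raise p T) j = level k T j + (if j = p then 2 else 0)"
    using cnt_raise [OF T, of j] q by (simp add: level_def)
  have st: "step (raise p T) j = step T j - (if j = p then 2 else 0) + (if j = q \<or> j
      = Suc p then 1 else 0)"
    using T q by (auto simp: step_def mem_raise)
  have nb: "j \<in> nbs n p \<longleftrightarrow> j \<in> Idx n \<and> (j = q \<or> j = Suc p)"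
    using q by (auto simp: nbs_def)
  have sl: "level k T j = s" if "j = q \<or> j = Suc p"
    using that T q by (auto simp: s_def level_def cnt_Suc)
  have sp: "step T p = 1" using T by (simp add: step_def)
  have A: "Poly_Mapping.lookup (Amon n p s) (j, l)
    = (if j = p \<and> (l = s - 1 \<or> l = s + 1) then 1 else 0) - (if j \<in> nbs n p \<and> l = s then 1 else 0)"
  proof -
    have "Poly_Mapping.lookup (\<Sum>j\<in>nbs n p. Ymon j s) (j, l) = (\<Sum>j'\<in>nbs n p.
        if j' = j then (if l = s then 1 else 0) else 0)"
      unfolding lookup_sum by (intro sum.cong) (auto simp: Ymon_def lookup_single when_def)
    then show ?thesis
      unfolding Amon_nbs lookup_minus lookup_add by (auto simp: Ymon_def lookup_single when_def)
  qed
  show "Poly_Mapping.lookup (column_mono n k (raise p T)) x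
    = Poly_Mapping.lookup (column_mono n k T - Amon n p (level k T p + 1)) x"
    unfolding x lookup_minus s_def [symmetric] A lookup_column_mono lev st nb
    using p sl q sp by (auto simp: s_def)
qed

definition columns :: "nat \<Rightarrow> nat \<Rightarrow> nat set set" where
  "columns n k = {T. T \<subseteq> {1..Suc n} \<and> card T = k}"

lemma finite_columns [simp]: "finite (columns n k)"
  by (rule finite_subset [of _ "Pow {1..Suc n}"]) (auto simp: columns_def)

text \<open>Summing over columns instead of monomials counts with multiplicity, which lets
  bijections of columns act directly.\<close>

definition column_character :: "nat \<Rightarrow> nat \<Rightarrow> mono \<Rightarrow> laurent" where
  "column_character n k m = (\<Sum>T\<in>columns n k. if column_mono n k T = m then 1 else 0)"

lemma column_mono_dominant:
  assumes "p \<in> Idx n" "p \<in> T \<or> Suc p \<notin> T"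
  shows "column_mono n k T \<in> dominant n {p}"
  using assms by (auto simp: dominant_def column_mono_Mon lookup_column_mono step_def)

text \<open>The hypothesis makes T the head of its p-string, so Y_p occurs with exponent 1 or not at
  all and \<open>Eit_thin\<close> applies; \<open>a\<close> undoes the undetermined power of
  t.\<close>

lemma Eit_column_mono:
  assumes p: "p \<in> Idx n" and T: "p \<in> T \<or> Suc p \<notin> T"
  shows "\<exists>a. \<forall>m. tpow a * Poly_Mapping.lookup (Eit n p (column_mono n k T)) m
    = (if column_mono n k T = m then 1 else 0)
      + (if p \<in> T \<and> Suc p \<notin> T then (if column_mono n k (raise p T) = m then 1 else 0) else 0)"
proof (cases "p \<in> T \<and> Suc p \<notin> T")
  case True
  let ?M = "column_mono n k T" and ?l = "level k T p"
  have thin: "is_thin n p ?M (Eit n p ?M)"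
    by (rule Eit_thin [OF p column_mono_dominant [OF p T]])
  have "Poly_Mapping.lookup ?M (p, l') = (if l' = ?l then 1 else 0)" for l'
    using True p by (simp add: lookup_column_mono step_def)
  from is_thin_pair [OF thin this] obtain a where
    a: "Eit n p ?M = Poly_Mapping.single ?M (tpow a) + Poly_Mapping.single (?M - Amon n p (?l
        + 1)) (tpow a)"
    by (auto simp: is_pair_def)
  have "tpow (- a) * Poly_Mapping.lookup (Eit n p ?M) m
     = (if ?M = m then 1 else 0) + (if column_mono n k (raise p T) = m then 1 else 0)" for m
    using True p unfolding a by (simp add: column_mono_raise lookup_add lookup_single when_def
        distrib_left tpow_mult)
  then show ?thesis using True by (intro exI [of _ "- a"]) simp
next
  case False
  let ?M = "column_mono n k T"
  have thin: "is_thin n p ?M (Eit n p ?M)"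
    by (rule Eit_thin [OF p column_mono_dominant [OF p T]])
  have "Poly_Mapping.lookup ?M (p, l') = 0" for l'
    using False p T by (auto simp: lookup_column_mono step_def)
  from is_thin_tmono [OF thin this] obtain a where "Eit n p ?M = Poly_Mapping.single ?M (tpow a)"
    by (auto simp: is_tmono_def)
  then have "tpow (- a) * Poly_Mapping.lookup (Eit n p ?M) m = (if ?M = m then 1 else 0)" for m
    by (simp add: lookup_single when_def tpow_mult)
  then show ?thesis using False by (intro exI [of _ "- a"]) auto
qed

lemma columns_swap:
  assumes "T \<in> columns n k" "x \<in> T" "y \<notin> T" "y \<in> {1..Suc n}"
  shows "insert y (T - {x}) \<in> columns n k"
proof -
  have "finite T" using assms(1) by (auto simp: columns_def intro: finite_subset)
  then have "card (insert y (T - {x})) = card T"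
    using assms(2,3) card_Suc_Diff1 [of T x] by simp
  then show ?thesis using assms unfolding columns_def by blast
qed

lemma bij_betw_raise:
  assumes "p \<in> Idx n"
  shows "bij_betw (raise p) {T \<in> columns n k. p \<in> T \<and> Suc p \<notin> T} {T \<in> columns n k. p \<notin> T \<and> Suc p
      \<in> T}"
proof (rule bij_betw_byWitness [where f' = "\<lambda>T. insert p (T - {Suc p})"])
  have p: "p \<in> {1..Suc n}" "Suc p \<in> {1..Suc n}" using assms by (simp_all add: Idx_def)
  show "raise p ` {T \<in> columns n k. p \<in> T \<and> Suc p \<notin> T} \<subseteq> {T \<in> columns n k. p \<notin> T \<and> Suc p \<in> T}"
    using columns_swap [OF _ _ _ p(2)] by (auto simp: raise_def)
  show "(\<lambda>T. insert p (T - {Suc p})) ` {T \<in> columns n k. p \<notin> T \<and> Suc p \<in> T} \<subseteq> {T \<in> columns n k. p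
      \<in> T \<and> Suc p \<notin> T}"
    using columns_swap [OF _ _ _ p(1)] by auto
qed (auto simp: raise_def)

text \<open>The columns split into p-strings of one or two elements. Their heads form
  \<open>X\<close>; the other columns \<open>?X2\<close> are the raised ones, supplied by the second
  members of the pairs.\<close>

lemma column_character_expansion:
  assumes p: "p \<in> Idx n"
  shows "\<exists>c. expansion n p c (column_character n k)"
proof -
  let ?m = "column_mono n k"
  define X where "X = {T \<in> columns n k. p \<in> T \<or> Suc p \<notin> T}"
  let ?X1 = "{T \<in> columns n k. p \<in> T \<and> Suc p \<notin> T}" and ?X2 = "{T \<in> columns n k. p \<notin> T \<and> Suc p \<in> T}"
  have fin: "finite X" by (simp add: X_def)
  define Q where "Q T b \<longleftrightarrow> (\<forall>m. tpow b * Poly_Mapping.lookup (Eit n p (?m T)) m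
    = (if ?m T = m then 1 else 0) + (if p \<in> T \<and> Suc p \<notin> T then (if ?m (raise p T)
        = m then 1 else 0) else 0))"
    for T b
  have "\<exists>b. Q T b" if "T \<in> X" for T
    unfolding Q_def using that by (intro Eit_column_mono [OF p]) (simp add: X_def)
  then obtain a where "\<And>T. T \<in> X \<Longrightarrow> Q T (a T)" by metis
  note a = this [unfolded Q_def, rule_format]
  \<comment> \<open>A sum over T, so that columns sharing a monomial have their contributions
    added.\<close>
  define c where "c m = (\<Sum>T\<in>X. if ?m T = m then tpow (a T) else 0)" for m
  have supp: "m \<in> ?m ` X" if "c m \<noteq> 0" for m
  proof (rule ccontr)
    assume "m \<notin> ?m ` X"
    then have "c m = 0" unfolding c_def by (intro sum.neutral) auto
    with that show False by contradiction
  qed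
  have "m \<in> dominant n {p}" if "c m \<noteq> 0" for m
    using supp [OF that] column_mono_dominant [OF p] by (auto simp: X_def)
  moreover have "finite {m. c m \<noteq> 0 \<and> H \<le> height n m}" for H
    by (rule finite_subset [of _ "?m ` X"]) (use supp fin in auto)
  moreover have "column_character n k m = Sum_any (\<lambda>m'. c m'
      * Poly_Mapping.lookup (Eit n p m') m)" for m
  proof -
    let ?E = "\<lambda>m'. Poly_Mapping.lookup (Eit n p m') m" and ?\<delta> = "\<lambda>T.
        if ?m T = m then 1 else 0 :: laurent"
    have "Sum_any (\<lambda>m'. c m' * ?E m') = (\<Sum>m'\<in>?m ` X. c m' * ?E m')"
      by (rule Sum_any.expand_superset) (use supp fin in auto)
    also have "\<dots> = (\<Sum>m'\<in>?m ` X. \<Sum>T\<in>X. if m' = ?m T then tpow (a T) * ?E m' else 0)"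
      unfolding c_def sum_distrib_right by (intro sum.cong) auto
    also have "\<dots> = (\<Sum>T\<in>X. \<Sum>m'\<in>?m ` X. if m' = ?m T then tpow (a T) * ?E m' else 0)"
      by (rule sum.swap)
    also have "\<dots> = (\<Sum>T\<in>X. tpow (a T) * ?E (?m T))"
      using fin by (intro sum.cong) (simp_all add: sum.delta)
    also have "\<dots> = (\<Sum>T\<in>X. ?\<delta> T) + (\<Sum>T\<in>X. if p \<in> T \<and> Suc p \<notin> T then ?\<delta> (raise p T) else 0)"
      using a by (simp add: sum.distrib)
    also have "(\<Sum>T\<in>X. if p \<in> T \<and> Suc p \<notin> T then ?\<delta> (raise p T) else 0) = (\<Sum>T\<in>?X1. ?\<delta> (raise p T))"
      by (subst sum.inter_filter [symmetric, OF fin]) (auto simp: X_def intro!: sum.cong)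
    also have "\<dots> = (\<Sum>T\<in>?X2. ?\<delta> T)"
      by (rule sum.reindex_bij_betw [OF bij_betw_raise [OF p]])
    also have "(\<Sum>T\<in>X. ?\<delta> T) + (\<Sum>T\<in>?X2. ?\<delta> T) = (\<Sum>T\<in>X \<union> ?X2. ?\<delta> T)"
      by (rule sum.union_disjoint [symmetric]) (auto simp: X_def)
    also have "X \<union> ?X2 = columns n k" by (auto simp: X_def)
    finally show ?thesis by (simp add: column_character_def)
  qed
  ultimately have "expansion n p c (column_character n k)" unfolding expansion_def by blast
  then show ?thesis by (rule exI [of _ c])
qed

text \<open>A negative exponent at j occurs exactly if j + 1 is in T and j is not, so dominance
  closes T downwards.\<close>

lemma dominant_column:
  assumes T: "T \<in> columns n k" and k: "k \<in> Idx n" and dom: "column_mono n k T \<in> dominant n (Idx n)"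
  shows "T = {1..k}"
proof -
  have fin: "finite T" and sub: "T \<subseteq> {1..Suc n}" and card: "card T = k"
    using T by (auto simp: columns_def intro: finite_subset)
  have down: "j \<in> T" if "Suc j \<in> T" "1 \<le> j" for j
  proof -
    have "j \<in> Idx n" using that sub by (auto simp: Idx_def)
    then have "0 \<le> Poly_Mapping.lookup (column_mono n k T) (j, level k T j)"
      using dom unfolding dominant_def by blast
    then have "0 \<le> step T j" using \<open>j \<in> Idx n\<close> by (simp add: lookup_column_mono)
    then show ?thesis using that by (auto simp: step_def split: if_splits)
  qed
  have "T \<noteq> {}" using card k by (auto simp: Idx_def)
  then have M: "Max T \<in> T" using fin by simp
  have "j \<in> T" if "1 \<le> j" "j \<le> Max T" for j
    using that(2,1) by (induction rule: inc_induct) (use M down in auto)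
  then have "T = {1..Max T}" using sub Max_ge [OF fin] by force
  moreover from this have "k = Max T" using card by (metis card_atLeastAtMost diff_Suc_1)
  ultimately show ?thesis by simp
qed

text \<open>Here the summand k in \<open>level\<close> takes effect: k + k - 2k = 0 is the level of
  the single variable.\<close>

lemma column_mono_initial:
  assumes "k \<in> Idx n"
  shows "column_mono n k {1..k} = Ymon k 0"
proof (rule poly_mapping_eqI)
  fix x :: "nat \<times> int"
  obtain j l where x: "x = (j, l)" by (cases x)
  have "step {1..k} j = (if j = k then 1 else 0)" if "j \<in> Idx n"
    using that assms by (auto simp: step_def Idx_def)
  moreover have "level k {1..k} k = 0"
    by (simp add: level_def cnt_def)
  ultimately show "Poly_Mapping.lookup (column_mono n k {1..k}) x
      = Poly_Mapping.lookup (Ymon k 0) x"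
    using assms by (auto simp: x lookup_column_mono Ymon_def lookup_single when_def)
qed

lemma column_character_dominant:
  assumes k: "k \<in> Idx n" and m: "m \<in> dominant n (Idx n)"
  shows "column_character n k m = (if m = Ymon k 0 then 1 else 0)"
proof -
  have mem: "{1..k} \<in> columns n k" using k by (auto simp: columns_def Idx_def)
  have "column_character n k m = (\<Sum>T\<in>columns n k.
      if T = {1..k} then (if m = Ymon k 0 then 1 else 0) else 0)"
    unfolding column_character_def
  proof (rule sum.cong [OF refl])
    fix T assume T: "T \<in> columns n k"
    show "(if column_mono n k T = m then 1 else 0 :: laurent)
      = (if T = {1..k} then (if m = Ymon k 0 then 1 else 0) else 0)"
      using dominant_column [OF T k] m column_mono_initial [OF k] by auto
  qed
  then show ?thesis using mem by simp
qed

text \<open>Used twice: it gives the uniqueness behind the definite description \<open>Ft\<close>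
  and then its value.\<close>

lemma is_Ft_column_character:
  assumes i: "i \<in> Idx n" and F: "is_Ft n i F"
  shows "F = column_character n i"
proof
  fix m
  let ?G = "column_character n i"
  have "F m - ?G m = 0"
  proof (rule expansions_dominant_zero)
    show "Idx n \<noteq> {}" using i by blast
  next
    fix j assume j: "j \<in> Idx n"
    then have "F \<in> Kit_inf n j" using F by (auto simp: is_Ft_def Kt_inf_def)
    then show "\<exists>c. expansion n j c (\<lambda>m. F m - ?G m)"
      using Kit_inf_expansion [OF j] column_character_expansion [OF j] expansion_diff [OF j]
          by blast
  next
    fix m assume m: "m \<in> dominant n (Idx n)"
    have "{m \<in> dominant n (Idx n). F m \<noteq> 0} = {Ymon i 0}" "F (Ymon i 0) = 1"
      using F by (simp_all add: is_Ft_def)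
    then show "F m - ?G m = 0"
      using m by (auto simp: column_character_dominant [OF i m])
  qed
  then show "F m = ?G m" by simp
qed

theorem proposition7p1:
  fixes n i :: nat
  assumes "n \<ge> 1" and "i \<in> Idx n"
    and existence: "\<exists>F. is_Ft n i F"
  shows "\<forall>m\<in>Mon n. \<forall>k. Poly_Mapping.lookup (Ft n i m) k \<ge> 0"
proof -
  have "is_Ft n i (Ft n i)"
    unfolding Ft_def using existence is_Ft_column_character [OF assms(2)] by (metis theI)
  then have "Ft n i = column_character n i"
    by (rule is_Ft_column_character [OF assms(2)])
  moreover have "0 \<le> Poly_Mapping.lookup (column_character n i m) k" for m k
    unfolding column_character_def lookup_sum by (intro sum_nonneg) (simp add: lookup_one when_def)
  ultimately show ?thesis by simp
qed

end
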